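(* The Dichromatic Number problem on digraphs with $n$ vertices that are given by a directed clique-width $k$-expression can be solved in time $n^{2^{O(k^2)}}$.
   Context: Dichromatic Number problem: given a digraph $G=(V,E)$ and a positive integer $r\leq |V|$, decide whether $V$ can be partitioned into $r$ sets each inducing a subdigraph with no directed cycle. A directed clique-width $k$-expression is an expression using labels $\{1,\dots,k\}$ built from the operations: $a(v)$, creating a new vertex $v$ with label $a$; $G\oplus H$, disjoint union of two labeled digraphs; $\alpha_{a,b}$ ($a\neq b$), inserting an arc from every vertex with label $a$ to every vertex with label $b$; $\rho_{a\to b}$, changing label $a$ into label $b$. The expression defines the digraph obtained by evaluating it and forgetting the labels.
   Formalization: The time bound n^{2^{O(k^2)}} is stated for n ≥ 2 and expressions with at most d·k²·n operations (for every fixed d); for arbitrary k-expressions, including n = 1, a polynomial in the number of operations is added to the running time. *)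

theory Defs
  imports
    "Graph_Theory.Graph_Theory"
    "HOL-Library.Disjoint_Sets"
    "HOL-Library.Landau_Symbols"
begin

section \<open>Directed clique-width expressions\<close>

datatype dcw_exp =
    Vertex nat nat               (* Vertex a v: the operation a(v) *)
  | DUnion dcw_exp dcw_exp
  | AddArcs nat nat dcw_exp      (* the operation alpha_{a,b} *)
  | Relabel nat nat dcw_exp      (* the operation rho_{a -> b} *)

primrec dcw_verts :: "dcw_exp \<Rightarrow> nat set" where
  "dcw_verts (Vertex a v) = {v}"
| "dcw_verts (DUnion X Y) = dcw_verts X \<union> dcw_verts Y"
| "dcw_verts (AddArcs a b X) = dcw_verts X"
| "dcw_verts (Relabel a b X) = dcw_verts X"

text \<open>Only the values on the vertices of the expression are meaningful; the two vertex sets of a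
  disjoint union are required to be disjoint in \<open>dcw_k_exp\<close> below.\<close>

primrec dcw_label :: "dcw_exp \<Rightarrow> nat \<Rightarrow> nat" where
  "dcw_label (Vertex a v) = (\<lambda>u. a)"
| "dcw_label (DUnion X Y) = (\<lambda>u. if u \<in> dcw_verts X then dcw_label X u else dcw_label Y u)"
| "dcw_label (AddArcs a b X) = dcw_label X"
| "dcw_label (Relabel a b X) = (\<lambda>u. if dcw_label X u = a then b else dcw_label X u)"

primrec dcw_arcs :: "dcw_exp \<Rightarrow> (nat \<times> nat) set" where
  "dcw_arcs (Vertex a v) = {}"
| "dcw_arcs (DUnion X Y) = dcw_arcs X \<union> dcw_arcs Y"
| "dcw_arcs (AddArcs a b X) = dcw_arcs X \<union>
     {(u, v). u \<in> dcw_verts X \<and> v \<in> dcw_verts X \<and> dcw_label X u = a \<and> dcw_label X v = b}"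
| "dcw_arcs (Relabel a b X) = dcw_arcs X"

definition dcw_digraph :: "dcw_exp \<Rightarrow> nat pair_pre_digraph" where
  "dcw_digraph X = \<lparr>pverts = dcw_verts X, parcs = dcw_arcs X\<rparr>"

primrec dcw_k_exp :: "nat \<Rightarrow> dcw_exp \<Rightarrow> bool" where
  "dcw_k_exp k (Vertex a v) \<longleftrightarrow> a \<in> {1..k}"
| "dcw_k_exp k (DUnion X Y) \<longleftrightarrow>
     dcw_k_exp k X \<and> dcw_k_exp k Y \<and> dcw_verts X \<inter> dcw_verts Y = {}"
| "dcw_k_exp k (AddArcs a b X) \<longleftrightarrow> a \<in> {1..k} \<and> b \<in> {1..k} \<and> a \<noteq> b \<and> dcw_k_exp k X"
| "dcw_k_exp k (Relabel a b X) \<longleftrightarrow> a \<in> {1..k} \<and> b \<in> {1..k} \<and> dcw_k_exp k X"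

text \<open>The number of operations of an expression.\<close>

primrec dcw_size :: "dcw_exp \<Rightarrow> nat" where
  "dcw_size (Vertex a v) = 1"
| "dcw_size (DUnion X Y) = dcw_size X + dcw_size Y + 1"
| "dcw_size (AddArcs a b X) = dcw_size X + 1"
| "dcw_size (Relabel a b X) = dcw_size X + 1"


section \<open>The Dichromatic Number problem\<close>

definition acyclic_digraph :: "('a, 'b) pre_digraph \<Rightarrow> bool" where
  "acyclic_digraph G \<longleftrightarrow> \<not> (\<exists>p. pre_digraph.cycle G p)"

definition acyclic_partitionable :: "'a pair_pre_digraph \<Rightarrow> nat \<Rightarrow> bool" where
  "acyclic_partitionable G r \<longleftrightarrow>
     (\<exists>P. partition_on (pverts G) P \<and> card P = r \<and>
          (\<forall>S\<in>P. acyclic_digraph (with_proj G \<restriction> S)))"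


section \<open>Model of computation\<close>

text \<open>
  Programs are systems of mutually recursive first-order functions over binary trees, evaluated
  call-by-value (the first-order functional language over cons cells, with \<open>nil\<close> as the only atom,
  of N. D. Jones, Computability and Complexity from a Programming Perspective, MIT Press 1997).
  Every evaluation of a subterm costs one time unit. There is no operation whose
  unit cost hides more than constant work: a cons cell is a pair of pointers, \<open>hd\<close>
  and \<open>tl\<close> follow a pointer, the conditional only tests for \<open>nil\<close>, and for a fixed program
  environments have bounded length. Hence running times agree up to polynomials with those of
  Turing machines and of RAMs with logarithmic cost.
\<close>

datatype tree = Leaf | Cell tree tree

datatype tm =
    TVar nat                     (* i-th argument of the current function *)
  | TNil
  | TCons tm tm
  | THd tm
  | TTl tm
  | TIf tm tm tm
  | TCall nat "tm list"          (* call of the i-th function of the program *)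

text \<open>A program is the list of the bodies of its functions.\<close>

type_synonym program = "tm list"

fun tree_hd :: "tree \<Rightarrow> tree" where
  "tree_hd Leaf = Leaf"
| "tree_hd (Cell x y) = x"

fun tree_tl :: "tree \<Rightarrow> tree" where
  "tree_tl Leaf = Leaf"
| "tree_tl (Cell x y) = y"

text \<open>\<open>eval P vs e x t\<close>: with arguments \<open>vs\<close>, term \<open>e\<close> evaluates to \<open>x\<close> in exactly \<open>t\<close> steps.
  A computation that diverges or gets stuck has no derivation.\<close>

inductive eval :: "program \<Rightarrow> tree list \<Rightarrow> tm \<Rightarrow> tree \<Rightarrow> nat \<Rightarrow> bool"
  and evals :: "program \<Rightarrow> tree list \<Rightarrow> tm list \<Rightarrow> tree list \<Rightarrow> nat \<Rightarrow> bool"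
  for P :: program
where
  eval_Var: "i < length vs \<Longrightarrow> eval P vs (TVar i) (vs ! i) 1"
| eval_Nil: "eval P vs TNil Leaf 1"
| eval_Cons: "eval P vs e1 x1 t1 \<Longrightarrow> eval P vs e2 x2 t2 \<Longrightarrow>
    eval P vs (TCons e1 e2) (Cell x1 x2) (t1 + t2 + 1)"
| eval_Hd: "eval P vs e x t \<Longrightarrow> eval P vs (THd e) (tree_hd x) (t + 1)"
| eval_Tl: "eval P vs e x t \<Longrightarrow> eval P vs (TTl e) (tree_tl x) (t + 1)"
| eval_If_true: "eval P vs e x t \<Longrightarrow> x \<noteq> Leaf \<Longrightarrow> eval P vs e1 x1 t1 \<Longrightarrow>
    eval P vs (TIf e e1 e2) x1 (t + t1 + 1)"
| eval_If_false: "eval P vs e Leaf t \<Longrightarrow> eval P vs e2 x2 t2 \<Longrightarrow>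
    eval P vs (TIf e e1 e2) x2 (t + t2 + 1)"
| eval_Call: "evals P vs es xs t \<Longrightarrow> i < length P \<Longrightarrow> eval P xs (P ! i) y t' \<Longrightarrow>
    eval P vs (TCall i es) y (t + t' + 1)"
| evals_Nil: "evals P vs [] [] 0"
| evals_Cons: "eval P vs e x t \<Longrightarrow> evals P vs es xs t' \<Longrightarrow>
    evals P vs (e # es) (x # xs) (t + t')"

inductive_cases eval_elims:
  "eval P vs (TVar i) x t" "eval P vs TNil x t" "eval P vs (TCons e1 e2) x t"
  "eval P vs (THd e) x t" "eval P vs (TTl e) x t" "eval P vs (TIf e e1 e2) x t"
  "eval P vs (TCall i es) x t" "evals P vs [] xs t" "evals P vs (e # es) xs t"

lemma eval_deterministic:
  "eval P vs e x t \<Longrightarrow> eval P vs e x' t' \<Longrightarrow> x' = x \<and> t' = t"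
  "evals P vs es xs u \<Longrightarrow> evals P vs es xs' u' \<Longrightarrow> xs' = xs \<and> u' = u"
proof (induction arbitrary: x' t' and xs' u' rule: eval_evals.inducts)
  case (eval_Var i vs)
  then show ?case by (auto elim: eval_elims)
next
  case (eval_Nil vs)
  then show ?case by (auto elim: eval_elims)
next
  case (eval_Cons vs e1 x1 t1 e2 x2 t2)
  from eval_Cons.prems eval_Cons.IH show ?case by (elim eval_elims(3)) force
next
  case (eval_Hd vs e x t)
  from eval_Hd.prems eval_Hd.IH show ?case by (elim eval_elims(4)) force
next
  case (eval_Tl vs e x t)
  from eval_Tl.prems eval_Tl.IH show ?case by (elim eval_elims(5)) force
next
  case (eval_If_true vs e x t e1 x1 t1 e2)
  from eval_If_true.prems
  obtain x2 s s2 where *: "eval P vs e x2 s" "t' = s + s2 + 1"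
    "if x2 \<noteq> Leaf then eval P vs e1 x' s2 else eval P vs e2 x' s2"
    by (rule eval_elims(6)) fastforce+
  moreover have "x2 = x \<and> s = t"
    using eval_If_true.IH(2) *(1) by blast
  ultimately show ?case
    using eval_If_true.IH(4)[of x' s2] eval_If_true.hyps *(2,3) by simp
next
  case (eval_If_false vs e t e2 y t2 e1)
  from eval_If_false.prems
  obtain x2 s s2 where *: "eval P vs e x2 s" "t' = s + s2 + 1"
    "if x2 \<noteq> Leaf then eval P vs e1 x' s2 else eval P vs e2 x' s2"
    by (rule eval_elims(6)) fastforce+
  moreover have "x2 = Leaf \<and> s = t"
    using eval_If_false.IH(2) *(1) by blast
  ultimately show ?case
    using eval_If_false.IH(4)[of x' s2] *(2,3) by simp
next
  case (eval_Call vs es xs t i y t1)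
  from eval_Call.prems eval_Call.IH show ?case by (elim eval_elims(7)) force
next
  case (evals_Nil vs)
  then show ?case by (auto elim: eval_elims)
next
  case (evals_Cons vs e x t es xs t1)
  from evals_Cons.prems evals_Cons.IH show ?case by (elim eval_elims(9)) force
qed

definition outputs_within :: "program \<Rightarrow> tree \<Rightarrow> tree \<Rightarrow> nat \<Rightarrow> bool" where
  "outputs_within P x y T \<longleftrightarrow> (\<exists>t\<le>T. eval P [x] (TCall 0 [TVar 0]) y t)"


section \<open>Encoding of instances\<close>

text \<open>Numbers are encoded in unary. This does not affect running times, since these are
  measured below in terms of the parameters of the instance and not of the size of its encoding.\<close>

primrec enc_nat :: "nat \<Rightarrow> tree" where
  "enc_nat 0 = Leaf"
| "enc_nat (Suc n) = Cell Leaf (enc_nat n)"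

text \<open>Every node carries the numbers 0 to 3 as a tag for the operation.\<close>

primrec enc_exp :: "dcw_exp \<Rightarrow> tree" where
  "enc_exp (Vertex a v) = Cell (enc_nat 0) (Cell (enc_nat a) (enc_nat v))"
| "enc_exp (DUnion X Y) = Cell (enc_nat 1) (Cell (enc_exp X) (enc_exp Y))"
| "enc_exp (AddArcs a b X) = Cell (enc_nat 2) (Cell (enc_nat a) (Cell (enc_nat b) (enc_exp X)))"
| "enc_exp (Relabel a b X) = Cell (enc_nat 3) (Cell (enc_nat a) (Cell (enc_nat b) (enc_exp X)))"

definition enc_bool :: "bool \<Rightarrow> tree" where
  "enc_bool b = (if b then Cell Leaf Leaf else Leaf)"

text \<open>An expression may be padded with arbitrarily many redundant operations, all of which an
  algorithm has to read, so a bound in terms of the number \<open>n\<close> of vertices and of \<open>k\<close> alone presupposes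
  the usual normalization to irredundant expressions, which have \<open>O(k\<^sup>2 n)\<close> operations. For
  arbitrary expressions (and for \<open>n = 1\<close>, where any power of \<open>n\<close> is \<open>1\<close>) a polynomial
  in \<open>dcw_size\<close> has to be added.\<close>

definition solves_dichromatic_within :: "program \<Rightarrow> dcw_exp \<Rightarrow> nat \<Rightarrow> nat \<Rightarrow> bool" where
  "solves_dichromatic_within P X r T \<longleftrightarrow>
     outputs_within P (Cell (enc_exp X) (enc_nat r))
       (enc_bool (acyclic_partitionable (dcw_digraph X) r)) T"

end

theory Submission
  imports Defs "HOL-Combinatorics.Permutations"
begin

text \<open>
  The algorithm is dynamic programming over the expression. A colouring with \<open>r\<close> colours, all of
  whose classes are acyclic, is summarised by the multiset of the \<open>r\<close> relations on labels that
  record, for each class, which labels are joined by a directed path inside the class (empty classes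
  are allowed; since \<open>r\<close> is at most the number of vertices,
    a colouring can be refined to a partition
  into exactly \<open>r\<close> classes). This state determines how further operations act: \<open>\<alpha>\<^bsub>a,b\<^esub>\<close> closes a
  cycle in a class iff its relation contains \<open>(b, a)\<close>,
    and in a disjoint union the classes of the two
  sides are paired off in all possible ways. There are at most \<open>(r + 1) ^ 2 ^ k\<^sup>2\<close> states, and the
  classes of one side are merged one after the other into those of the other side, so that only
  pairs of partial states have to be stored. Hence the size \<open>B\<close> of all data is \<open>n ^ 2 ^ O(k\<^sup>2)\<close> and
  every operation costs \<open>B ^ O(1)\<close>; the product of this with the number of operations is at most the
  sum of their squares.
\<close>

section \<open>Trees as lists, sets and multisets\<close>

text \<open>Tables stay small only if equal states are recognised, and the machine can compare
  nothing but trees. Hence sets and multisets are encoded as sorted lists: equal objects have equal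
  trees, and insertion into a set finds duplicates. Trying all bijections between the classes of two
  states would cost about \<open>r!\<close>; partial merges that agree in the multisets of free and
  of merged relations are identified instead. The base \<open>r + 1\<close> with an exponent
  depending on \<open>k\<close> alone is the source of the doubly exponential form of the bound. The
  time analysis is kept free of constants. One number \<open>B\<close> bounds all cardinalities and
  encoding sizes, a loop contributes one factor \<open>B\<close>, and since \<open>B\<close> is at
  least 1000 a further factor pays for constants. Unary labels do no harm, being at most
  \<open>k\<close>, and vertex names are never inspected. A power of \<open>n\<close> can reach 1000
  only if \<open>n\<close> is at least 2, so single-vertex digraphs are answered separately.\<close>

instantiation tree :: linorder
begin

text \<open>Any computable linear order on trees would serve for sorting; this lexicographic one is
  decided by the short recursion \<open>leq_body\<close>.\<close>

fun less_eq_tree :: "tree \<Rightarrow> tree \<Rightarrow> bool" where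
  "less_eq_tree Leaf y = True"
| "less_eq_tree (Cell a b) Leaf = False"
| "less_eq_tree (Cell a b) (Cell c d) = (if a = c then less_eq_tree b d else less_eq_tree a c)"

definition less_tree :: "tree \<Rightarrow> tree \<Rightarrow> bool" where
  "less_tree x y \<longleftrightarrow> x \<le> y \<and> \<not> y \<le> x"

instance
proof
  fix x y z :: tree
  show "x < y \<longleftrightarrow> x \<le> y \<and> \<not> y \<le> x"
    by (rule less_tree_def)
  show "x \<le> x"
    by (induction x) auto
  show antisym: "x \<le> y \<Longrightarrow> y \<le> x \<Longrightarrow> x = y" for x y :: tree
    by (induction x y rule: less_eq_tree.induct) (auto elim: less_eq_tree.elims split: if_splits)
  show "x \<le> y \<Longrightarrow> y \<le> z \<Longrightarrow> x \<le> z"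
  proof (induction x y arbitrary: z rule: less_eq_tree.induct)
    case (3 a b c d)
    then show ?case
      by (cases z) (auto split: if_splits dest: antisym)
  qed auto
  show "x \<le> y \<or> y \<le> x"
    by (induction x y rule: less_eq_tree.induct) auto
qed

end

primrec lst :: "tree list \<Rightarrow> tree" where
  "lst [] = Leaf"
| "lst (x # xs) = Cell x (lst xs)"

text \<open>A canonical form: on finite sets, structural equality of trees decides equality of
  sets.\<close>

definition set_tree :: "tree set \<Rightarrow> tree" where
  "set_tree A = lst (sorted_list_of_set A)"

definition mset_tree :: "tree multiset \<Rightarrow> tree" where
  "mset_tree M = lst (sorted_list_of_multiset M)"

primrec nodes :: "tree \<Rightarrow> nat" where
  "nodes Leaf = 1"
| "nodes (Cell x y) = nodes x + nodes y + 1"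

lemma nodes_pos [simp]: "1 \<le> nodes x" "nodes x \<noteq> 0" "0 < nodes x"
  by (cases x; simp)+

lemma lst_inject [simp]: "lst xs = lst ys \<longleftrightarrow> xs = ys"
proof (induction xs arbitrary: ys)
  case Nil
  then show ?case by (cases ys) auto
next
  case (Cons x xs)
  then show ?case by (cases ys) auto
qed

lemma nodes_lst: "nodes (lst xs) = 1 + (\<Sum>x\<leftarrow>xs. nodes x + 1)"
  by (induction xs) auto

lemma length_less_nodes_lst: "length xs < nodes (lst xs)"
  by (induction xs) (auto simp: less_Suc_eq_le)

lemma set_tree_eq_iff: "finite A \<Longrightarrow> finite B \<Longrightarrow> set_tree A = set_tree B \<longleftrightarrow> A = B"
  by (metis lst_inject set_tree_def set_sorted_list_of_set)

lemma mset_tree_eq_iff: "mset_tree M = mset_tree N \<longleftrightarrow> M = N"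
  by (metis lst_inject mset_tree_def mset_sorted_list_of_multiset)

text \<open>The encodings are sorted, not the encoded objects, so the sorted list is pulled back
  along \<open>f\<close>. The abstract list obtained in this way is what the running-time inductions
  run over.\<close>

lemma set_tree_image_lst:
  assumes "finite A" "inj_on f A"
  obtains xs where "set_tree (f ` A) = lst (map f xs)" "set xs = A" "distinct xs"
proof -
  let ?ys = "sorted_list_of_set (f ` A)"
  let ?xs = "map (inv_into A f) ?ys"
  have s: "set ?ys = f ` A" using assms by simp
  have "map f ?xs = ?ys"
    unfolding map_map by (rule map_idI) (use s in \<open>auto simp: f_inv_into_f\<close>)
  moreover have "set ?xs = A"
    using s assms by (simp add: image_image)
  moreover have "distinct ?xs"
    by (metis calculation(1) distinct_map sorted_list_of_set.distinct_sorted_key_list_of_set)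
  ultimately show ?thesis
    using that[of ?xs] by (simp add: set_tree_def)
qed

lemma mset_eq_image_mset:
  "mset xs = image_mset f M \<Longrightarrow> \<exists>ys. xs = map f ys \<and> mset ys = M"
proof (induction xs arbitrary: M)
  case (Cons x xs)
  then obtain y M' where "M = add_mset y M'" "x = f y" "mset xs = image_mset f M'"
    by (metis mset.simps(2) msed_map_invR)
  with Cons.IH[of M'] show ?case
    by (metis list.simps(9) mset.simps(2))
qed auto

lemma mset_tree_image_lst:
  obtains xs where "mset_tree (image_mset f M) = lst (map f xs)" "mset xs = M"
  by (metis mset_eq_image_mset mset_sorted_list_of_multiset mset_tree_def)

section \<open>Evaluation of programs\<close>

text \<open>Continuation style turns the evaluation of a body into a rewriting problem: by determinism,
  the equations below hold unconditionally.\<close>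

definition ok :: "program \<Rightarrow> tree list \<Rightarrow> tm \<Rightarrow> (tree \<Rightarrow> nat \<Rightarrow> bool) \<Rightarrow> bool" where
  "ok P vs e Q \<longleftrightarrow> (\<exists>x t. eval P vs e x t \<and> Q x t)"

definition oks :: "program \<Rightarrow> tree list \<Rightarrow> tm list \<Rightarrow> (tree list \<Rightarrow> nat \<Rightarrow> bool) \<Rightarrow> bool" where
  "oks P vs es Q \<longleftrightarrow> (\<exists>xs t. evals P vs es xs t \<and> Q xs t)"

definition halts :: "program \<Rightarrow> nat \<Rightarrow> tree list \<Rightarrow> bool" where
  "halts P i xs \<longleftrightarrow> i < length P \<and> ok P xs (P ! i) (\<lambda>x t. True)"

definition res :: "program \<Rightarrow> nat \<Rightarrow> tree list \<Rightarrow> tree" where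
  "res P i xs = (THE y. \<exists>t. eval P xs (P ! i) y t)"

definition time :: "program \<Rightarrow> nat \<Rightarrow> tree list \<Rightarrow> nat" where
  "time P i xs = (THE t. \<exists>y. eval P xs (P ! i) y t)"

lemma res_time_eq:
  assumes "eval P xs (P ! i) y t"
  shows "res P i xs = y" "time P i xs = t"
  using assms eval_deterministic(1) unfolding res_def time_def by blast+

text \<open>A call is not unfolded: it leaves \<open>halts\<close>, \<open>res\<close> and
  \<open>time\<close> of the callee, which \<open>runs\<close> facts supply. Rewriting therefore
  stops at recursive calls, and an induction hypothesis can take over there.\<close>

lemma ok_simps:
  "ok P vs (TVar i) Q \<longleftrightarrow> i < length vs \<and> Q (vs ! i) 1"
  "ok P vs TNil Q \<longleftrightarrow> Q Leaf 1"
  "ok P vs (TCons e e') Q \<longleftrightarrow> ok P vs e (\<lambda>x t. ok P vs e' (\<lambda>y s. Q (Cell x y) (t + s + 1)))"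
  "ok P vs (THd e) Q \<longleftrightarrow> ok P vs e (\<lambda>x t. Q (tree_hd x) (t + 1))"
  "ok P vs (TTl e) Q \<longleftrightarrow> ok P vs e (\<lambda>x t. Q (tree_tl x) (t + 1))"
  "ok P vs (TIf e e1 e2) Q \<longleftrightarrow> ok P vs e (\<lambda>x t. if x \<noteq> Leaf
     then ok P vs e1 (\<lambda>y s. Q y (t + s + 1)) else ok P vs e2 (\<lambda>y s. Q y (t + s + 1)))"
  "ok P vs (TCall i es) Q \<longleftrightarrow>
     oks P vs es (\<lambda>xs t. halts P i xs \<and> Q (res P i xs) (t + time P i xs + 1))"
  "oks P vs [] R \<longleftrightarrow> R [] 0"
  "oks P vs (e # es) R \<longleftrightarrow> ok P vs e (\<lambda>x t. oks P vs es (\<lambda>xs s. R (x # xs) (t + s)))"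
proof -
  show "ok P vs (TIf e e1 e2) Q \<longleftrightarrow> ok P vs e (\<lambda>x t. if x \<noteq> Leaf
     then ok P vs e1 (\<lambda>y s. Q y (t + s + 1)) else ok P vs e2 (\<lambda>y s. Q y (t + s + 1)))" (is "?L =
       ?R")
  proof
    assume ?L
    then show ?R
      unfolding ok_def by (auto elim!: eval_elims(6))
  next
    assume ?R
    then show ?L
      unfolding ok_def using eval_If_true[of P vs e] eval_If_false[of P vs e]
      by (auto split: if_splits) (metis Suc_eq_plus1)+
  qed
  show "ok P vs (TCall i es) Q \<longleftrightarrow>
     oks P vs es (\<lambda>xs t. halts P i xs \<and> Q (res P i xs) (t + time P i xs + 1))" (is "?L = ?R")
  proof
    assume ?L
    then obtain xs t y t' where *: "evals P vs es xs t" "i < length P" "eval P xs (P ! i) y t'"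
      "Q y (t + t' + 1)"
      unfolding ok_def by (auto elim!: eval_elims(7))
    then show ?R
      unfolding oks_def halts_def ok_def using res_time_eq[OF *(3)] by metis
  next
    assume ?R
    then obtain xs t y t' where "evals P vs es xs t" "i < length P" "eval P xs (P ! i) y t'"
      "Q (res P i xs) (t + time P i xs + 1)"
      unfolding ok_def oks_def halts_def by blast
    then show ?L
      unfolding ok_def using eval_Call res_time_eq by metis
  qed
qed ((auto simp: ok_def oks_def intro: eval_evals.intros elim!: eval_elims;
    metis eval_Var eval_Nil eval_Cons eval_Hd eval_Tl Suc_eq_plus1 One_nat_def)+)

definition runs :: "program \<Rightarrow> nat \<Rightarrow> tree list \<Rightarrow> tree \<Rightarrow> nat \<Rightarrow> bool" where
  "runs P i xs y T \<longleftrightarrow> halts P i xs \<and> res P i xs = y \<and> time P i xs \<le> T"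

lemma runsI: "i < length P \<Longrightarrow> ok P xs (P ! i) (\<lambda>x t. x = y \<and> t \<le> T) \<Longrightarrow> runs P i xs y T"
  unfolding runs_def halts_def ok_def using res_time_eq by metis

lemma runs_mono: "runs P i xs y S \<Longrightarrow> S \<le> T \<Longrightarrow> runs P i xs y T"
  by (simp add: runs_def)

lemma runs_imp_eval: "runs P i xs y T \<Longrightarrow> \<exists>t\<le>T. eval P xs (P ! i) y t"
  unfolding runs_def halts_def ok_def using res_time_eq by metis

section \<open>The program\<close>

abbreviation (input) TTrue :: tm where "TTrue \<equiv> TCons TNil TNil"

abbreviation (input) main_fn :: nat where "main_fn \<equiv> 0"
text \<open>\<open>Suc 0\<close> is the simplifier's normal form of 1, so that
  \<open>dichrom_nth\<close> still matches after simplification.\<close>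

abbreviation (input) has_union_fn :: nat where "has_union_fn \<equiv> Suc 0"
abbreviation (input) eq_fn :: nat where "eq_fn \<equiv> 2"
abbreviation (input) leq_fn :: nat where "leq_fn \<equiv> 3"
abbreviation (input) ins_fn :: nat where "ins_fn \<equiv> 4"
abbreviation (input) ins_all_fn :: nat where "ins_all_fn \<equiv> 5"
abbreviation (input) pick_fn :: nat where "pick_fn \<equiv> 6"
abbreviation (input) step_fn :: nat where "step_fn \<equiv> 7"
abbreviation (input) steps_fn :: nat where "steps_fn \<equiv> 8"
abbreviation (input) start_fn :: nat where "start_fn \<equiv> 9"
abbreviation (input) finish_fn :: nat where "finish_fn \<equiv> 10"
abbreviation (input) product_fn :: nat where "product_fn \<equiv> 11"
abbreviation (input) relabel_fn :: nat where "relabel_fn \<equiv> 12"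
abbreviation (input) arcs_from_fn :: nat where "arcs_from_fn \<equiv> 13"
abbreviation (input) arcs_fn :: nat where "arcs_fn \<equiv> 14"
abbreviation (input) member_fn :: nat where "member_fn \<equiv> 15"
abbreviation (input) op_rel_fn :: nat where "op_rel_fn \<equiv> 16"
abbreviation (input) op_state_fn :: nat where "op_state_fn \<equiv> 17"
abbreviation (input) closes_cycle_fn :: nat where "closes_cycle_fn \<equiv> 18"
abbreviation (input) op_table_fn :: nat where "op_table_fn \<equiv> 19"
abbreviation (input) pad_fn :: nat where "pad_fn \<equiv> 20"
abbreviation (input) table_fn :: nat where "table_fn \<equiv> 21"

text \<open>The tag is inspected in unary: nil means a vertex, a nil tail of a non-nil tag means a
  disjoint union. Otherwise the operation is unary, and three \<open>TTl\<close> skip the tag and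
  both labels.\<close>

definition has_union_body :: tm where
  "has_union_body =
    TIf (THd (TVar 0))
      (TIf (TTl (THd (TVar 0))) (TCall has_union_fn [TTl (TTl (TTl (TVar 0)))]) TTrue)
      TNil"

definition eq_body :: tm where
  "eq_body =
    TIf (TVar 0)
      (TIf (TVar 1)
         (TIf (TCall eq_fn [THd (TVar 0), THd (TVar 1)])
            (TCall eq_fn [TTl (TVar 0), TTl (TVar 1)])
            TNil)
         TNil)
      (TIf (TVar 1) TNil TTrue)"

definition leq_body :: tm where
  "leq_body =
    TIf (TVar 0)
      (TIf (TVar 1)
         (TIf (TCall eq_fn [THd (TVar 0), THd (TVar 1)])
            (TCall leq_fn [TTl (TVar 0), TTl (TVar 1)])
            (TCall leq_fn [THd (TVar 0), THd (TVar 1)]))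
         TNil)
      TTrue"

text \<open>A non-nil first argument suppresses duplicates: sets are strictly sorted lists, multisets
  sorted ones.\<close>

definition ins_body :: tm where
  "ins_body =
    TIf (TVar 2)
      (TIf (TCall leq_fn [TVar 1, THd (TVar 2)])
         (TIf (TVar 0)
            (TIf (TCall eq_fn [TVar 1, THd (TVar 2)]) (TVar 2) (TCons (TVar 1) (TVar 2)))
            (TCons (TVar 1) (TVar 2)))
         (TCons (THd (TVar 2)) (TCall ins_fn [TVar 0, TVar 1, TTl (TVar 2)])))
      (TCons (TVar 1) TNil)"

definition ins_all_body :: tm where
  "ins_all_body =
    TIf (TVar 1)
      (TCall ins_fn [TVar 0, THd (TVar 1), TCall ins_all_fn [TVar 0, TTl (TVar 1), TVar 2]])
      (TVar 2)"

text \<open>Arguments: the relation of the class to be merged, the classes already skipped, those still to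
  be tried, the classes merged so far, and an accumulator. One result is added for every choice of
  a partner class.\<close>

definition pick_body :: tm where
  "pick_body =
    TIf (TVar 2)
      (TCall ins_fn
         [TTrue,
          TCons (TCall ins_all_fn [TNil, TTl (TVar 2), TVar 1])
            (TCall ins_fn [TNil, TCall ins_all_fn [TTrue, TVar 0, THd (TVar 2)], TVar 3]),
          TCall pick_fn
            [TVar 0,
             TCall ins_fn [TNil, THd (TVar 2), TVar 1],
             TTl (TVar 2),
             TVar 3,
             TVar 4]])
      (TVar 4)"

text \<open>Each entry of the table is a pair of free and merged classes. The result for the
  remaining entries is passed to \<open>pick_fn\<close> as accumulator, so the union over all
  entries is formed without a separate pass.\<close>

definition step_body :: tm where
  "step_body =
    TIf (TVar 1)
      (TCall pick_fn
         [TVar 0,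
          TNil,
          THd (THd (TVar 1)),
          TTl (THd (TVar 1)),
          TCall step_fn [TVar 0, TTl (TVar 1)]])
      TNil"

definition steps_body :: tm where
  "steps_body =
    TIf (TVar 0)
      (TCall steps_fn [TTl (TVar 0), TCall step_fn [THd (TVar 0), TVar 1]])
      (TVar 1)"

definition start_body :: tm where
  "start_body =
    TIf (TVar 0)
      (TCall ins_fn [TTrue, TCons (THd (TVar 0)) TNil, TCall start_fn [TTl (TVar 0)]])
      TNil"

definition finish_body :: tm where
  "finish_body =
    TIf (TVar 0)
      (TCall ins_fn [TTrue, TTl (THd (TVar 0)), TCall finish_fn [TTl (TVar 0), TVar 1]])
      (TVar 1)"

definition product_body :: tm where
  "product_body =
    TIf (TVar 0)
      (TCall finish_fn
         [TCall steps_fn [THd (TVar 0), TCall start_fn [TVar 1]],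
          TCall product_fn [TTl (TVar 0), TVar 1]])
      TNil"

definition relabel_body :: tm where
  "relabel_body =
    TIf (TVar 2)
      (TCall ins_fn
         [TTrue,
          TCons (TIf (TCall eq_fn [THd (THd (TVar 2)), TVar 0])
                   (TVar 1)
                   (THd (THd (TVar 2))))
            (TIf (TCall eq_fn [TTl (THd (TVar 2)), TVar 0]) (TVar 1) (TTl (THd (TVar 2)))),
          TCall relabel_fn [TVar 0, TVar 1, TTl (TVar 2)]])
      TNil"

definition arcs_from_body :: tm where
  "arcs_from_body =
    TIf (TVar 2)
      (TIf (TCall eq_fn [THd (THd (TVar 2)), TVar 1])
         (TCall ins_fn
            [TTrue,
             TCons (TVar 0) (TTl (THd (TVar 2))),
             TCall arcs_from_fn [TVar 0, TVar 1, TTl (TVar 2), TVar 3]])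
         (TCall arcs_from_fn [TVar 0, TVar 1, TTl (TVar 2), TVar 3]))
      (TVar 3)"

text \<open>A double loop: this function searches for pairs \<open>(x, a)\<close>, and
  \<open>arcs_from_fn\<close> for pairs \<open>(b, y)\<close>. The relation is therefore needed in
  three roles: traversed by the outer loop, traversed by the inner loop, and as initial
  accumulator.\<close>

definition arcs_body :: tm where
  "arcs_body =
    TIf (TVar 2)
      (TIf (TCall eq_fn [TTl (THd (TVar 2)), TVar 0])
         (TCall arcs_from_fn
            [THd (THd (TVar 2)),
             TVar 1,
             TVar 3,
             TCall arcs_fn [TVar 0, TVar 1, TTl (TVar 2), TVar 3, TVar 4]])
         (TCall arcs_fn [TVar 0, TVar 1, TTl (TVar 2), TVar 3, TVar 4]))
      (TVar 4)"

definition member_body :: tm where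
  "member_body =
    TIf (TVar 1)
      (TIf (TCall eq_fn [TVar 0, THd (TVar 1)])
         TTrue
         (TCall member_fn [TVar 0, TTl (TVar 1)]))
      TNil"

text \<open>A non-nil first argument of \<open>op_rel\<close>, \<open>op_state\<close> and \<open>op_table\<close> selects the relabelling,
  and nil the insertion of arcs.\<close>

definition op_rel_body :: tm where
  "op_rel_body =
    TIf (TVar 0)
      (TCall relabel_fn [TVar 1, TVar 2, TVar 3])
      (TCall arcs_fn [TVar 1, TVar 2, TVar 3, TVar 3, TVar 3])"

definition op_state_body :: tm where
  "op_state_body =
    TIf (TVar 3)
      (TCall ins_fn
         [TNil,
          TCall op_rel_fn [TVar 0, TVar 1, TVar 2, THd (TVar 3)],
          TCall op_state_fn [TVar 0, TVar 1, TVar 2, TTl (TVar 3)]])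
      TNil"

definition closes_cycle_body :: tm where
  "closes_cycle_body =
    TIf (TVar 2)
      (TIf (TCall member_fn [TCons (TVar 1) (TVar 0), THd (TVar 2)])
         TTrue
         (TCall closes_cycle_fn [TVar 0, TVar 1, TTl (TVar 2)]))
      TNil"

definition op_table_body :: tm where
  "op_table_body =
    TIf (TVar 3)
      (TIf (TIf (TVar 0) TNil (TCall closes_cycle_fn [TVar 1, TVar 2, THd (TVar 3)]))
         (TCall op_table_fn [TVar 0, TVar 1, TVar 2, TTl (TVar 3)])
         (TCall ins_fn
            [TTrue,
             TCall op_state_fn [TVar 0, TVar 1, TVar 2, THd (TVar 3)],
             TCall op_table_fn [TVar 0, TVar 1, TVar 2, TTl (TVar 3)]]))
      TNil"

text \<open>The classes that contain no vertex have the empty relation.\<close>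

definition pad_body :: tm where
  "pad_body =
    TIf (TVar 1) (TCall ins_fn [TNil, TNil, TCall pad_fn [TVar 0, TTl (TVar 1)]]) (TVar 0)"

text \<open>Dropping two cells from the tag of a unary operation turns 2 into nil and 3 into a
  single cell, which is exactly the flag expected by \<open>op_table_fn\<close>. At a vertex,
  \<open>TTl\<close> of the unary \<open>r\<close> gives the \<open>r - 1\<close> empty classes to
  be added.\<close>

definition table_body :: tm where
  "table_body =
    TIf (THd (TVar 0))
      (TIf (TTl (THd (TVar 0)))
         (TCall op_table_fn
            [TTl (TTl (THd (TVar 0))),
             THd (TTl (TVar 0)),
             THd (TTl (TTl (TVar 0))),
             TCall table_fn [TTl (TTl (TTl (TVar 0))), TVar 1]])
         (TCall product_fn
            [TCall table_fn [THd (TTl (TVar 0)), TVar 1],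
             TCall table_fn [TTl (TTl (TVar 0)), TVar 1]]))
      (TCons (TCall pad_fn
                [TCons (TCons (TCons (THd (TTl (TVar 0))) (THd (TTl (TVar 0)))) TNil) TNil,
                 TTl (TVar 1)])
         TNil)"

text \<open>An expression without disjoint union has a single vertex; its labels, which may be large
  compared to the size of the expression, are not even read.\<close>

definition main_body :: tm where
  "main_body =
    TIf (TCall has_union_fn [THd (TVar 0)])
      (TIf (TCall table_fn [THd (TVar 0), TTl (TVar 0)]) TTrue TNil)
      TTrue"

definition dichrom :: program where
  "dichrom = [main_body, has_union_body, eq_body, leq_body, ins_body,
     ins_all_body, pick_body, step_body, steps_body, start_body,
     finish_body, product_body, relabel_body, arcs_from_body, arcs_body,
     member_body, op_rel_body, op_state_body, closes_cycle_body, op_table_body,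
     pad_body, table_body]"

lemma dichrom_nth:
  "dichrom ! main_fn = main_body"
  "dichrom ! has_union_fn = has_union_body"
  "dichrom ! eq_fn = eq_body"
  "dichrom ! leq_fn = leq_body"
  "dichrom ! ins_fn = ins_body"
  "dichrom ! ins_all_fn = ins_all_body"
  "dichrom ! pick_fn = pick_body"
  "dichrom ! step_fn = step_body"
  "dichrom ! steps_fn = steps_body"
  "dichrom ! start_fn = start_body"
  "dichrom ! finish_fn = finish_body"
  "dichrom ! product_fn = product_body"
  "dichrom ! relabel_fn = relabel_body"
  "dichrom ! arcs_from_fn = arcs_from_body"
  "dichrom ! arcs_fn = arcs_body"
  "dichrom ! member_fn = member_body"
  "dichrom ! op_rel_fn = op_rel_body"
  "dichrom ! op_state_fn = op_state_body"
  "dichrom ! closes_cycle_fn = closes_cycle_body"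
  "dichrom ! op_table_fn = op_table_body"
  "dichrom ! pad_fn = pad_body"
  "dichrom ! table_fn = table_body"
  by (simp_all add: dichrom_def)

lemma length_dichrom [simp]: "length dichrom = 22"
  by (simp add: dichrom_def)

lemmas body_defs = dichrom_nth
  main_body_def has_union_body_def eq_body_def leq_body_def
  ins_body_def ins_all_body_def pick_body_def step_body_def
  steps_body_def start_body_def finish_body_def product_body_def
  relabel_body_def arcs_from_body_def arcs_body_def member_body_def
  op_rel_body_def op_state_body_def closes_cycle_body_def op_table_body_def
  pad_body_def table_body_def

primrec has_union :: "dcw_exp \<Rightarrow> bool" where
  "has_union (Vertex a v) \<longleftrightarrow> False"
| "has_union (DUnion X Y) \<longleftrightarrow> True"
| "has_union (AddArcs a b X) \<longleftrightarrow> has_union X"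
| "has_union (Relabel a b X) \<longleftrightarrow> has_union X"

lemma enc_nat_numeral [simp]:
  "enc_nat 2 = Cell Leaf (Cell Leaf Leaf)" "enc_nat 3 = Cell Leaf (Cell Leaf (Cell Leaf Leaf))"
  by (simp_all add: numeral_eq_Suc)

lemma length_sorted_list_of_multiset [simp]: "length (sorted_list_of_multiset M) = size M"
  by (metis mset_sorted_list_of_multiset size_mset)

lemma set_tree_insert:
  assumes "finite A"
  shows "set_tree (insert x A) = lst (insort_insert x (sorted_list_of_set A))"
proof (cases "x \<in> A")
  case True
  with assms show ?thesis
    by (simp add: set_tree_def insort_insert_key_def insert_absorb)
next
  case False
  with assms show ?thesis
    by (simp add: set_tree_def insort_insert_key_def)
qed

section \<open>Sorted lists\<close>

abbreviation does :: "nat \<Rightarrow> tree list \<Rightarrow> tree \<Rightarrow> nat \<Rightarrow> bool" where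
  "does \<equiv> runs dichrom"

text \<open>The recursion follows the first argument and stops with it, so the second one may be
  arbitrarily large.\<close>

lemma eq_runs: "does eq_fn [x, y] (enc_bool (x = y)) (20 * nodes x)"
proof (induction x arbitrary: y)
  case Leaf
  show ?case
    by (rule runsI) (simp_all add: body_defs ok_simps enc_bool_def)
next
  case (Cell a b)
  show ?case
  proof (cases y)
    case Leaf
    then show ?thesis
      by (intro runsI) (simp_all add: body_defs ok_simps enc_bool_def)
  next
    case [simp]: (Cell c d)
    show ?thesis
      using Cell.IH(1)[of c] Cell.IH(2)[of d]
      by (intro runsI) (auto simp: body_defs ok_simps enc_bool_def runs_def split: if_splits)
  qed
qed

text \<open>Every level runs an equality test before descending, which makes the cost quadratic. The
  mixed terms of the square, of which \<open>120 * nodes a\<close> is kept, pay for that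
  test.\<close>

lemma leq_runs: "does leq_fn [x, y] (enc_bool (x \<le> y)) (60 * nodes x ^ 2)"
proof (induction x y rule: less_eq_tree.induct)
  case (1 y)
  show ?case
    by (rule runsI) (simp_all add: body_defs ok_simps enc_bool_def)
next
  case (2 a b)
  show ?case
    by (rule runsI) (simp_all add: body_defs ok_simps enc_bool_def power2_eq_square)
next
  case (3 a b c d)
  have *: "60 * nodes (Cell a b) ^ 2 \<ge> 60 * nodes a ^ 2 + 60 * nodes b ^ 2 + 60 + 120 * nodes a"
    by (simp add: power2_eq_square algebra_simps)
  show ?case
    using 3 eq_runs[of a c] *
    by (intro runsI) (auto simp: body_defs ok_simps enc_bool_def runs_def split: if_splits)
qed

lemma ins_runs_list:
  assumes "sorted ys" "nodes x \<le> B"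
  shows "does ins_fn [enc_bool d, x, lst ys] (lst (if d then insort_insert x ys else insort x ys))
    ((length ys + 1) * (100 * B ^ 2))"
  using assms(1)
proof (induction ys)
  case Nil
  have "B \<ge> 1"
    using assms(2) nodes_pos(1) order_trans by blast
  then have "B ^ 2 \<ge> 1"
    by simp
  then show ?case
    by (intro runsI) (simp_all add: body_defs ok_simps insort_insert_key_def)
next
  case (Cons y ys)
  have "B \<ge> 1"
    using assms(2) nodes_pos(1) order_trans by blast
  then have B2: "B ^ 2 \<ge> 1" "B \<le> B ^ 2" "nodes x ^ 2 \<le> B ^ 2"
    using assms(2) by (auto simp: power2_eq_square mult_le_mono)
  \<comment> \<open>By sortedness, comparing \<open>x\<close> with the head alone decides
    membership, so the program need not search further for duplicates.\<close>
  have "x \<notin> set ys" if "x \<le> y" "x \<noteq> y"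
    using that Cons.prems by fastforce
  moreover have "does leq_fn [x, y] (enc_bool (x \<le> y)) (60 * B ^ 2)"
    by (rule runs_mono[OF leq_runs]) (use B2(3) in simp)
  ultimately show ?case
    using eq_runs[of x y] Cons B2(1,2) assms(2)
    by (intro runsI)
      (auto simp: body_defs ok_simps enc_bool_def runs_def insort_insert_key_def split: if_splits)
qed

lemma has_union_runs:
  "does has_union_fn [enc_exp X] (enc_bool (has_union X)) (20 * dcw_size X)"
  by (induction X; rule runsI)
    (simp_all add: body_defs ok_simps enc_bool_def runs_def)

text \<open>\<open>B\<close> will bound the size of all data. The threshold 1000 is generous: it
  lets one additional factor \<open>B\<close> absorb the constant cost of a pass through a function
  body.\<close>

locale budget =
  fixes B :: nat
  assumes large: "1000 \<le> B"
begin

lemma pow_Suc_ge: "1000 * B ^ j \<le> B ^ Suc j"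
  using large by simp

lemma square_ge: "1000 * B \<le> B ^ 2"
  using large by (simp add: power2_eq_square)

lemma pow_large: "0 < j \<Longrightarrow> 1000 \<le> B ^ j"
  using large by (metis Suc_leI one_le_numeral le_trans power_increasing power_one_right
    One_nat_def)

lemma pow_mono: "i \<le> j \<Longrightarrow> B ^ i \<le> B ^ j"
  using large by (simp add: power_increasing)

lemma loop_bound: "n < B \<Longrightarrow> (n + 1) * B ^ j \<le> B ^ Suc j"
  by (simp add: Suc_leI del: mult_Suc)

text \<open>The list versions of the running-time lemmas have the bound
  \<open>(n + 1) * B ^ j\<close>, where the extra 1 is the last call, on the empty list. A loop thus
  raises the exponent by one.\<close>

lemma runs_loop: "does i xs y ((n + 1) * B ^ j) \<Longrightarrow> n < B \<Longrightarrow> does i xs y (B ^ Suc j)"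
  using loop_bound runs_mono by blast

lemma ins_bound:
  assumes "n < B"
  shows "(n + 1) * (100 * B ^ 2) \<le> B ^ 4"
proof -
  have "(n + 1) * (100 * B ^ 2) \<le> B * (B * B ^ 2)"
    using assms large by (intro mult_le_mono) auto
  then show ?thesis
    by (simp add: numeral_eq_Suc)
qed

lemma ins_set_runs:
  assumes "nodes x \<le> B" "finite A" "card A < B"
  shows "does ins_fn [Cell Leaf Leaf, x, set_tree A] (set_tree (insert x A)) (B ^ 4)"
  using ins_runs_list[of "sorted_list_of_set A" x B True] assms
    ins_bound[of "card A"]
  by (simp add: set_tree_insert) (simp add: set_tree_def enc_bool_def runs_mono)

lemma ins_mset_runs:
  assumes "nodes x \<le> B" "size M < B"
  shows "does ins_fn [Leaf, x, mset_tree M] (mset_tree (add_mset x M)) (B ^ 4)"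
  using ins_runs_list[of "sorted_list_of_multiset M" x B False] assms
    ins_bound[of "size M"]
  by (auto simp: mset_tree_def enc_bool_def elim: runs_mono)

lemma ins_all_set_runs:
  assumes "\<And>x. x \<in> set xs \<Longrightarrow> nodes x \<le> B" "finite A" "card (set xs \<union> A) < B"
  shows "does ins_all_fn [Cell Leaf Leaf, lst xs, set_tree A] (set_tree (set xs \<union> A))
    ((length xs + 1) * B ^ 5)"
  using assms
proof (induction xs)
  case Nil
  show ?case
    using pow_Suc_ge[of 4] pow_large[of 4]
    by (intro runsI) (simp_all add: body_defs ok_simps)
next
  case (Cons x xs)
  have card: "card (set xs \<union> A) < B"
    using Cons.prems(2,3) by (intro le_less_trans[OF card_mono Cons.prems(3)]) auto
  have "does ins_fn [Cell Leaf Leaf, x, set_tree (set xs \<union> A)] (set_tree (set (x # xs) \<union> A))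
    (B ^ 4)"
    using ins_set_runs[of x "set xs \<union> A"] Cons.prems card by simp
  with Cons.IH Cons.prems(1,2) card show ?case
    using pow_Suc_ge[of 4] pow_large[of 4]
    by (intro runsI) (simp_all add: body_defs ok_simps runs_def)
qed

lemma ins_all_mset_runs:
  assumes "\<And>x. x \<in> set xs \<Longrightarrow> nodes x \<le> B" "length xs + size M \<le> B"
  shows "does ins_all_fn [Leaf, lst xs, mset_tree M] (mset_tree (mset xs + M))
    ((length xs + 1) * B ^ 5)"
  using assms
proof (induction xs)
  case Nil
  show ?case
    using pow_Suc_ge[of 4] pow_large[of 4]
    by (intro runsI) (simp_all add: body_defs ok_simps)
next
  case (Cons x xs)
  have "does ins_fn [Leaf, x, mset_tree (mset xs + M)] (mset_tree (mset (x # xs) + M)) (B ^ 4)"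
    using ins_mset_runs[of x "mset xs + M"] Cons.prems by simp
  with Cons show ?case
    using pow_Suc_ge[of 4] pow_large[of 4]
    by (intro runsI) (simp_all add: body_defs ok_simps runs_def)
qed

lemma member_runs:
  assumes "nodes x \<le> B"
  shows "does member_fn [x, lst xs] (enc_bool (x \<in> set xs)) ((length xs + 1) * B ^ 2)"
proof (induction xs)
  case Nil
  show ?case
    using pow_Suc_ge[of 0] pow_mono[of 1 2] large
    by (intro runsI) (simp_all add: body_defs ok_simps enc_bool_def)
next
  case (Cons y ys)
  with eq_runs[of x y] assms show ?case
    using square_ge large
    by (intro runsI) (auto simp: body_defs ok_simps enc_bool_def runs_def split: if_splits)
qed

end

section \<open>States and their encoding\<close>

definition enc_pair :: "nat \<times> nat \<Rightarrow> tree" where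
  "enc_pair p = Cell (enc_nat (fst p)) (enc_nat (snd p))"

definition enc_rel :: "(nat \<times> nat) set \<Rightarrow> tree" where
  "enc_rel R = set_tree (enc_pair ` R)"

definition enc_state :: "(nat \<times> nat) set multiset \<Rightarrow> tree" where
  "enc_state M = mset_tree (image_mset enc_rel M)"

definition enc_merge :: "(nat \<times> nat) set multiset \<times> (nat \<times> nat) set multiset \<Rightarrow> tree" where
  "enc_merge p = Cell (enc_state (fst p)) (enc_state (snd p))"

definition rels :: "nat \<Rightarrow> (nat \<times> nat) set set" where
  "rels k = Pow ({1..k} \<times> {1..k})"

definition states :: "nat \<Rightarrow> nat \<Rightarrow> (nat \<times> nat) set multiset set" where
  "states k r = {M. set_mset M \<subseteq> rels k \<and> size M = r}"

text \<open>Partial merges: classes still free, and classes already merged. A step moves one class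
  from the first component to the second, so the total stays \<open>r\<close>.\<close>

definition merges ::
  "nat \<Rightarrow> nat \<Rightarrow> ((nat \<times> nat) set multiset \<times> (nat \<times> nat) set multiset) set" where
  "merges k r = {(M, N). set_mset M \<subseteq> rels k \<and> set_mset N \<subseteq> rels k \<and> size M + size N = r}"

definition relabel_rel :: "nat \<Rightarrow> nat \<Rightarrow> (nat \<times> nat) set \<Rightarrow> (nat \<times> nat) set" where
  "relabel_rel a b R =
     (\<lambda>(x, y). (if x = a then b else x, if y = a then b else y)) ` R"

text \<open>One product suffices because a path needs the new arcs only once when
  \<open>(b, a)\<close> is not in \<open>R\<close>, the only case in which \<open>op_table\<close>
  keeps the state. Paths that begin or end at a new arc are covered since relations of classes also
  record paths of length zero.\<close>

definition arcs_rel :: "nat \<Rightarrow> nat \<Rightarrow> (nat \<times> nat) set \<Rightarrow> (nat \<times> nat) set" where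
  "arcs_rel a b R = R \<union> {x. (x, a) \<in> R} \<times> {y. (b, y) \<in> R}"

definition op_rel :: "bool \<Rightarrow> nat \<Rightarrow> nat \<Rightarrow> (nat \<times> nat) set \<Rightarrow> (nat \<times> nat) set" where
  "op_rel g a b R = (if g then relabel_rel a b R else arcs_rel a b R)"

definition op_table ::
  "bool \<Rightarrow> nat \<Rightarrow> nat \<Rightarrow> (nat \<times> nat) set multiset set \<Rightarrow> (nat \<times> nat) set multiset set" where
  "op_table g a b T = image_mset (op_rel g a b) ` {M \<in> T. g \<or> (\<forall>R\<in>#M. (b, a) \<notin> R)}"

definition step_merges ::
  "(nat \<times> nat) set \<Rightarrow> ((nat \<times> nat) set multiset \<times> (nat \<times> nat) set multiset) set \<Rightarrow>
    ((nat \<times> nat) set multiset \<times> (nat \<times> nat) set multiset) set" where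
  "step_merges R S =
     (\<Union>(M, N)\<in>S. (\<lambda>Q. (M - {#Q#}, add_mset (R \<union> Q) N)) ` set_mset M)"

text \<open>\<open>Z\<close> is a pairing of the classes of two states that does not name the
  classes: its two projections are the states.\<close>

definition merge_tables :: "(nat \<times> nat) set multiset set \<Rightarrow> (nat \<times> nat) set multiset set \<Rightarrow>
    (nat \<times> nat) set multiset set" where
  "merge_tables S T = {image_mset (\<lambda>(x, y). x \<union> y) Z |Z. image_mset fst Z \<in> S \<and>
    image_mset snd Z \<in> T}"

lemma enc_nat_inject [simp]: "enc_nat a = enc_nat b \<longleftrightarrow> a = b"
proof (induction a arbitrary: b)
  case 0
  show ?case by (cases b) auto
next
  case (Suc a)
  then show ?case by (cases b) auto
qed

lemma enc_pair_inject [simp]: "enc_pair p = enc_pair q \<longleftrightarrow> p = q"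
  by (simp add: enc_pair_def prod_eq_iff)

lemma inj_enc_pair: "inj_on enc_pair A"
  by (simp add: inj_on_def)

lemma finite_rels: "R \<in> rels k \<Longrightarrow> finite R"
  unfolding rels_def using finite_subset[of R "{1..k} \<times> {1..k}"] by blast

text \<open>The restriction to \<open>rels k\<close> provides finiteness;
  \<open>sorted_list_of_set\<close> sends all infinite sets to the empty list.\<close>

lemma inj_enc_rel: "inj_on enc_rel (rels k)"
proof (rule inj_onI)
  fix R Q assume "R \<in> rels k" "Q \<in> rels k" "enc_rel R = enc_rel Q"
  then have "enc_pair ` R = enc_pair ` Q"
    by (simp add: enc_rel_def set_tree_eq_iff finite_rels)
  then show "R = Q"
    by (simp add: inj_image_eq_iff[OF inj_enc_pair])
qed

lemma enc_state_inject:
  assumes "set_mset M \<subseteq> rels k" "set_mset N \<subseteq> rels k" "enc_state M = enc_state N"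
  shows "M = N"
proof (rule multiset.inj_map_strong)
  show "image_mset enc_rel M = image_mset enc_rel N"
    using assms(3) by (simp add: enc_state_def mset_tree_eq_iff)
qed (use assms inj_enc_rel[of k] in \<open>auto simp: inj_on_def\<close>)

lemma inj_enc_state: "inj_on enc_state (states k r)"
  by (auto intro!: inj_onI enc_state_inject simp: states_def)

lemma inj_enc_merge: "inj_on enc_merge (merges k r)"
  by (auto intro!: inj_onI enc_state_inject simp: merges_def enc_merge_def)

lemma enc_empty [simp]: "set_tree {} = Leaf" "mset_tree {#} = Leaf" "enc_rel {} = Leaf"
  "enc_state {#} = Leaf"
  by (simp_all add: set_tree_def mset_tree_def enc_rel_def enc_state_def)

lemma rels_Un [simp]: "R \<in> rels k \<Longrightarrow> Q \<in> rels k \<Longrightarrow> R \<union> Q \<in> rels k"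
  by (auto simp: rels_def)

lemma op_rel_in_rels:
  "R \<in> rels k \<Longrightarrow> a \<in> {1..k} \<Longrightarrow> b \<in> {1..k} \<Longrightarrow> op_rel g a b R \<in> rels k"
  by (auto simp: rels_def op_rel_def relabel_rel_def arcs_rel_def split: if_splits)

lemma step_merges_subset:
  assumes "R \<in> rels k" "S \<subseteq> merges k r"
  shows "step_merges R S \<subseteq> merges k r"
proof
  fix p assume "p \<in> step_merges R S"
  then obtain M N Q where p: "(M, N) \<in> S" "Q \<in># M" "p = (M - {#Q#}, add_mset (R \<union> Q) N)"
    by (auto simp: step_merges_def)
  then obtain M' where "M = add_mset Q M'"
    by (metis insert_DiffM)
  moreover have "(M, N) \<in> merges k r"
    using p assms(2) by blast
  ultimately show "p \<in> merges k r"
    using p(3) assms(1) by (auto simp: merges_def)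
qed

text \<open>Multiplicities embed these multisets into the functions from \<open>A\<close> to
  \<open>{..r}\<close>. The estimate is crude, but it keeps \<open>r\<close> in the base and
  \<open>card A\<close> in the exponent.\<close>

lemma finite_card_msets:
  assumes "finite A"
  shows "finite {M. set_mset M \<subseteq> A \<and> size M \<le> r}"
    and "card {M. set_mset M \<subseteq> A \<and> size M \<le> r} \<le> (r + 1) ^ card A"
proof -
  let ?S = "{M. set_mset M \<subseteq> A \<and> size M \<le> r}"
  let ?f = "\<lambda>M. restrict (count M) A"
  have inj: "inj_on ?f ?S"
  proof (rule inj_onI, rule multiset_eqI)
    fix M N x assume "M \<in> ?S" "N \<in> ?S" "?f M = ?f N"
    then show "count M x = count N x"
    proof (cases "x \<in> A")
      case True
      with \<open>?f M = ?f N\<close> show ?thesis by (metis restrict_apply')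
    next
      case False
      with \<open>M \<in> ?S\<close> \<open>N \<in> ?S\<close> have "x \<notin># M" "x \<notin># N" by auto
      then show ?thesis by (simp add: not_in_iff)
    qed
  qed
  have sub: "?f ` ?S \<subseteq> A \<rightarrow>\<^sub>E {..r}"
    by (auto simp: restrict_PiE_iff intro: order_trans[OF count_le_size])
  have fin: "finite (A \<rightarrow>\<^sub>E {..r})"
    using assms by (simp add: finite_PiE)
  show "finite ?S"
    by (rule finite_imageD[OF finite_subset[OF sub fin] inj])
  have "card ?S = card (?f ` ?S)"
    using inj by (simp add: card_image)
  also have "\<dots> \<le> card (A \<rightarrow>\<^sub>E {..r})"
    using sub fin by (rule card_mono[rotated])
  also have "\<dots> = (r + 1) ^ card A"
    using assms by (simp add: card_PiE)
  finally show "card ?S \<le> (r + 1) ^ card A" .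
qed

lemma finite_card_merges:
  "finite (merges k r)" "card (merges k r) \<le> (r + 1) ^ (2 * 2 ^ (k\<^sup>2))"
proof -
  let ?S = "{M. set_mset M \<subseteq> rels k \<and> size M \<le> r}"
  have rels: "finite (rels k)" "card (rels k) = 2 ^ (k\<^sup>2)"
    by (simp_all add: rels_def card_Pow power2_eq_square)
  have sub: "merges k r \<subseteq> ?S \<times> ?S"
    by (auto simp: merges_def)
  have fin: "finite (?S \<times> ?S)"
    using finite_card_msets(1)[OF rels(1)] by simp
  show "finite (merges k r)"
    using sub fin by (rule finite_subset)
  have "card (merges k r) \<le> card ?S * card ?S"
    using card_mono[OF fin sub] by (simp add: card_cartesian_product)
  also have "\<dots> \<le> (r + 1) ^ (2 ^ (k\<^sup>2)) * (r + 1) ^ (2 ^ (k\<^sup>2))"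
    using finite_card_msets(2)[OF rels(1), of r] rels(2) by (intro mult_le_mono) auto
  finally show "card (merges k r) \<le> (r + 1) ^ (2 * 2 ^ (k\<^sup>2))"
    by (simp add: power_add[symmetric] mult_2)
qed

text \<open>Everything stored during a run fits into the budget, so the running-time lemmas below
  only have to track exponents of \<open>B\<close>. Strictness of the cardinality bounds is what
  \<open>runs_loop\<close> asks for.\<close>

locale universe = budget +
  fixes k r :: nat
  assumes card_merges: "card (merges k r) < B"
    and nodes_merge: "p \<in> merges k r \<Longrightarrow> nodes (enc_merge p) \<le> B"
    and nodes_rel: "R \<in> rels k \<Longrightarrow> nodes (enc_rel R) \<le> B"
    and r: "r < B"
begin

lemma merges_subset_bounds:
  assumes "S \<subseteq> merges k r"
  shows "finite S" "card S < B" "card (enc_merge ` S) < B"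
proof -
  show fin: "finite S"
    using assms finite_card_merges(1) by (rule finite_subset)
  show "card S < B"
    using card_mono[OF finite_card_merges(1) assms] card_merges by simp
  then show "card (enc_merge ` S) < B"
    using card_image_le[OF fin, of enc_merge] by simp
qed

lemma nodes_states:
  assumes "(M, N) \<in> merges k r"
  shows "nodes (enc_state M) \<le> B" "nodes (enc_state N) \<le> B"
  using nodes_merge[OF assms] by (simp_all add: enc_merge_def)

text \<open>States are the partial merges in which nothing has been merged yet; through this
  embedding they inherit all bounds assumed for \<open>merges k r\<close>.\<close>

lemma state_imp_merge: "M \<in> states k r \<Longrightarrow> (M, {#}) \<in> merges k r"
  by (simp add: merges_def states_def)

lemma states_subset_bounds:
  assumes "T \<subseteq> states k r"
  shows "finite T" "card (enc_state ` T) < B" "card T < B"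
proof -
  have sub: "(\<lambda>M. (M, {#})) ` T \<subseteq> merges k r"
    using assms state_imp_merge by blast
  have inj: "inj_on (\<lambda>M. (M, {#})) T"
    by (simp add: inj_on_def)
  show fin: "finite T"
    using merges_subset_bounds(1)[OF sub] inj by (rule finite_imageD)
  have "card T = card ((\<lambda>M. (M, {#} :: (nat \<times> nat) set multiset)) ` T)"
    by (rule card_image[symmetric]) (simp add: inj_on_def)
  also have "\<dots> \<le> card (merges k r)"
    using sub by (rule card_mono[OF finite_card_merges(1)])
  finally show *: "card T < B"
    using card_merges by simp
  then show "card (enc_state ` T) < B"
    using card_image_le[OF fin, of enc_state] by simp
qed

text \<open>A list is shorter than its encoding has nodes, so the size bound for encoded relations
  also bounds their cardinality.\<close>

lemma card_pairs:
  assumes "R \<in> rels k"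
  shows "card (enc_pair ` R) < B" "card R < B"
proof -
  have "card (enc_pair ` R) < nodes (enc_rel R)"
    using length_less_nodes_lst[of "sorted_list_of_set (enc_pair ` R)"]
      by (simp add: enc_rel_def set_tree_def)
  then show "card (enc_pair ` R) < B"
    using nodes_rel[OF assms] by simp
  then show "card R < B"
    by (simp add: card_image[OF inj_enc_pair])
qed

lemma nodes_pair: "a \<in> {1..k} \<Longrightarrow> b \<in> {1..k} \<Longrightarrow> nodes (enc_pair (a, b)) \<le> B"
  using nodes_rel[of "{(a, b)}"] by (simp add: rels_def enc_rel_def set_tree_def)

lemma nodes_label: "a \<in> {1..k} \<Longrightarrow> nodes (enc_nat a) \<le> B"
  using nodes_pair[of a a] by (simp add: enc_pair_def)

lemma rel_list:
  assumes "R \<in> rels k"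
  obtains ps where "enc_rel R = lst (map enc_pair ps)" "set ps = R" "length ps < B"
proof -
  obtain ps where ps: "enc_rel R = lst (map enc_pair ps)" "set ps = R" "distinct ps"
    using set_tree_image_lst[OF finite_rels[OF assms] inj_enc_pair] unfolding enc_rel_def by metis
  with card_pairs(2)[OF assms] distinct_card[OF ps(3)] that show ?thesis
    by simp
qed

lemma state_list:
  obtains Rs where "enc_state M = lst (map enc_rel Rs)" "mset Rs = M"
  using mset_tree_image_lst[of enc_rel M] unfolding enc_state_def by metis

lemma table_list:
  assumes "T \<subseteq> states k r"
  obtains Ms where "set_tree (enc_state ` T) = lst (map enc_state Ms)" "set Ms = T" "length Ms < B"
proof -
  obtain Ms where Ms: "set_tree (enc_state ` T) = lst (map enc_state Ms)" "set Ms = T" "distinct Ms"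
    using set_tree_image_lst[OF states_subset_bounds(1)[OF assms]
      inj_on_subset[OF inj_enc_state assms]]
    by metis
  with states_subset_bounds(3)[OF assms] distinct_card[OF Ms(3)] that show ?thesis
    by simp
qed

lemma merge_list:
  assumes "S \<subseteq> merges k r"
  obtains Ss where "set_tree (enc_merge ` S) = lst (map enc_merge Ss)" "set Ss = S" "length Ss < B"
proof -
  obtain Ss where Ss: "set_tree (enc_merge ` S) = lst (map enc_merge Ss)" "set Ss = S" "distinct Ss"
    using set_tree_image_lst[OF merges_subset_bounds(1)[OF assms]
      inj_on_subset[OF inj_enc_merge assms]]
    by metis
  with merges_subset_bounds(2)[OF assms] distinct_card[OF Ss(3)] that show ?thesis
    by simp
qed

lemma ins_rel_runs:
  assumes "R \<in> rels k" "a \<in> {1..k}" "b \<in> {1..k}"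
  shows "does ins_fn [Cell Leaf Leaf, Cell (enc_nat a) (enc_nat b), enc_rel R]
    (enc_rel (insert (a, b) R)) (B ^ 4)"
  using ins_set_runs[of "enc_pair (a, b)" "enc_pair ` R"] nodes_pair[of a b] card_pairs[of R]
    finite_rels[of R] assms by (simp add: enc_rel_def enc_pair_def)

lemma union_rel_runs:
  assumes "R \<in> rels k" "Q \<in> rels k"
  shows "does ins_all_fn [Cell Leaf Leaf, enc_rel R, enc_rel Q] (enc_rel (R \<union> Q)) (B ^ 6)"
proof -
  obtain ps where ps: "enc_rel R = lst (map enc_pair ps)" "set ps = R" "length ps < B"
    using assms(1) by (rule rel_list)
  have "card (set (map enc_pair ps) \<union> enc_pair ` Q) < B"
    using card_pairs(1)[of "R \<union> Q"] assms ps(2) by (simp add: image_Un)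
  moreover have "nodes x \<le> B" if x: "x \<in> set (map enc_pair ps)" for x
  proof -
    obtain p where "x = enc_pair p" "p \<in> R"
      using x unfolding set_map ps(2) by blast
    with assms(1) nodes_pair[of "fst p" "snd p"] show ?thesis
      by (auto simp: rels_def)
  qed
  ultimately have "does ins_all_fn [Cell Leaf Leaf, enc_rel R, enc_rel Q] (enc_rel (R \<union> Q))
      ((length ps + 1) * B ^ 5)"
    using ins_all_set_runs[of "map enc_pair ps" "enc_pair ` Q"] finite_rels[OF assms(2)] ps
    by (simp add: enc_rel_def image_Un)
  from runs_loop[OF this ps(3)] show ?thesis
    by simp
qed

lemma ins_state_runs:
  assumes "R \<in> rels k" "size M < r"
  shows "does ins_fn [Leaf, enc_rel R, enc_state M] (enc_state (add_mset R M)) (B ^ 4)"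
  using ins_mset_runs[of "enc_rel R" "image_mset enc_rel M"] nodes_rel assms r
  by (simp add: enc_state_def)

lemma union_state_runs:
  assumes "set Rs \<subseteq> rels k" "length Rs + size M \<le> r"
  shows "does ins_all_fn [Leaf, lst (map enc_rel Rs), enc_state M] (enc_state (mset Rs + M))
    (B ^ 6)"
proof -
  have *: "does ins_all_fn [Leaf, lst (map enc_rel Rs), enc_state M] (enc_state (mset Rs + M))
      ((length Rs + 1) * B ^ 5)"
    using ins_all_mset_runs[of "map enc_rel Rs" "image_mset enc_rel M"] nodes_rel assms r
    by (auto simp: enc_state_def)
  have "length Rs < B"
    using assms(2) r by simp
  from runs_loop[OF * this] show ?thesis
    by simp
qed

lemma ins_merge_runs:
  assumes "S \<subseteq> merges k r" "(M, N) \<in> merges k r"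
  shows "does ins_fn [Cell Leaf Leaf, Cell (enc_state M) (enc_state N), set_tree (enc_merge ` S)]
    (set_tree (enc_merge ` insert (M, N) S)) (B ^ 4)"
  using ins_set_runs[of "enc_merge (M, N)" "enc_merge ` S"] nodes_merge[OF assms(2)]
    merges_subset_bounds[OF assms(1)] by (simp add: enc_merge_def)

lemma ins_table_runs:
  assumes "T \<subseteq> states k r" "M \<in> states k r"
  shows "does ins_fn [Cell Leaf Leaf, enc_state M, set_tree (enc_state ` T)]
    (set_tree (enc_state ` insert M T)) (B ^ 4)"
  using ins_set_runs[of "enc_state M" "enc_state ` T"] nodes_states[OF state_imp_merge[OF assms(2)]]
    states_subset_bounds[OF assms(1)] by simp

end

section \<open>Running times on states\<close>

context universe
begin

section \<open>Relabelling and arc insertion on a single relation\<close>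

lemma relabel_runs_list:
  assumes "set ps \<subseteq> {1..k} \<times> {1..k}" "a \<in> {1..k}" "b \<in> {1..k}"
  shows "does relabel_fn [enc_nat a, enc_nat b, lst (map enc_pair ps)]
    (enc_rel (relabel_rel a b (set ps))) ((length ps + 1) * B ^ 5)"
  using assms(1)
proof (induction ps)
  case Nil
  show ?case
    using pow_large[of 5]
    by (intro runsI) (simp_all add: body_defs ok_simps relabel_rel_def)
next
  case (Cons p ps)
  obtain x y where p: "p = (x, y)"
    by (cases p)
  let ?f = "\<lambda>x. if x = a then b else x"
  have xy: "x \<in> {1..k}" "y \<in> {1..k}"
    using Cons.prems p by auto
  have fxy: "?f x \<in> {1..k}" "?f y \<in> {1..k}"
    using xy assms(3) by auto
  have "relabel_rel a b (set ps) \<in> rels k"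
    using op_rel_in_rels[of "set ps" k a b True] assms Cons.prems by (simp add: op_rel_def rels_def)
  from ins_rel_runs[OF this fxy]
  have "does ins_fn [Cell Leaf Leaf, Cell (enc_nat (?f x)) (enc_nat (?f y)),
    enc_rel (relabel_rel a b (set ps))]
      (enc_rel (relabel_rel a b (set (p # ps)))) (B ^ 4)"
    by (simp add: relabel_rel_def p)
  moreover have "20 * nodes (enc_nat x) \<le> 20 * B" "20 * nodes (enc_nat y) \<le> 20 * B"
    using xy nodes_label by auto
  moreover have "B \<le> B ^ 4"
    using pow_mono[of 1 4] by simp
  ultimately show ?case
    using eq_runs[of "enc_nat x" "enc_nat a"] eq_runs[of "enc_nat y" "enc_nat a"] Cons
      pow_Suc_ge[of 4] pow_large[of 4]
    by (intro runsI)
      (auto simp: body_defs ok_simps runs_def p enc_pair_def enc_bool_def split: if_splits)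
qed

lemma relabel_runs:
  assumes "R \<in> rels k" "a \<in> {1..k}" "b \<in> {1..k}"
  shows "does relabel_fn [enc_nat a, enc_nat b, enc_rel R] (enc_rel (relabel_rel a b R)) (B ^ 6)"
proof -
  obtain ps where ps: "enc_rel R = lst (map enc_pair ps)" "set ps = R" "length ps < B"
    using assms(1) by (rule rel_list)
  with runs_loop[OF relabel_runs_list[of ps a b] ps(3)] assms show ?thesis
    by (simp add: rels_def)
qed

lemma arcs_from_runs_list:
  assumes "set ps \<subseteq> {1..k} \<times> {1..k}" "x \<in> {1..k}" "R \<in> rels k"
  shows "does arcs_from_fn [enc_nat x, enc_nat b, lst (map enc_pair ps), enc_rel R]
    (enc_rel (R \<union> {x} \<times> {y. (b, y) \<in> set ps})) ((length ps + 1) * B ^ 5)"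
  using assms(1)
proof (induction ps)
  case Nil
  show ?case
    using pow_large[of 5]
    by (intro runsI) (simp_all add: body_defs ok_simps)
next
  case (Cons p ps)
  obtain z y where p: "p = (z, y)"
    by (cases p)
  have zy: "z \<in> {1..k}" "y \<in> {1..k}"
    using Cons.prems p by auto
  have "R \<union> {x} \<times> {y. (b, y) \<in> set ps} \<in> rels k"
    using assms(2,3) Cons.prems by (auto simp: rels_def)
  note ins = ins_rel_runs[OF this assms(2) zy(2)]
  have set_eq: "R \<union> {x} \<times> {y. (b, y) \<in> set (p # ps)} =
     (if z = b then insert (x, y) (R \<union> {x} \<times> {y. (b, y) \<in> set ps})
      else R \<union> {x} \<times> {y. (b, y) \<in> set ps})"
    by (auto simp: p)
  have "20 * nodes (enc_nat z) \<le> 20 * B"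
    using zy nodes_label by auto
  moreover have "B \<le> B ^ 4"
    using pow_mono[of 1 4] by simp
  ultimately show ?case
    using eq_runs[of "enc_nat z" "enc_nat b"] Cons ins
      pow_Suc_ge[of 4] pow_large[of 4] unfolding set_eq
    by (intro runsI)
      (auto simp: body_defs ok_simps runs_def p enc_pair_def enc_bool_def)
qed

lemma arcs_from_runs:
  assumes "Q \<in> rels k" "x \<in> {1..k}" "R \<in> rels k"
  shows "does arcs_from_fn [enc_nat x, enc_nat b, enc_rel Q, enc_rel R]
    (enc_rel (R \<union> {x} \<times> {y. (b, y) \<in> Q})) (B ^ 6)"
proof -
  obtain ps where ps: "enc_rel Q = lst (map enc_pair ps)" "set ps = Q" "length ps < B"
    using assms(1) by (rule rel_list)
  with runs_loop[OF arcs_from_runs_list[of ps x R b] ps(3)] assms show ?thesis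
    by (simp add: rels_def)
qed

lemma arcs_runs_list:
  assumes "set ps \<subseteq> {1..k} \<times> {1..k}" "R \<in> rels k" "Q \<in> rels k"
  shows "does arcs_fn [enc_nat a, enc_nat b, lst (map enc_pair ps), enc_rel Q, enc_rel R]
    (enc_rel (R \<union> {x. (x, a) \<in> set ps} \<times> {y. (b, y) \<in> Q})) ((length ps + 1) * B ^ 7)"
  using assms(1)
proof (induction ps)
  case Nil
  show ?case
    using pow_large[of 7]
    by (intro runsI) (simp_all add: body_defs ok_simps)
next
  case (Cons p ps)
  obtain x z where p: "p = (x, z)"
    by (cases p)
  have xz: "x \<in> {1..k}" "z \<in> {1..k}"
    using Cons.prems p by auto
  have "R \<union> {x. (x, a) \<in> set ps} \<times> {y. (b, y) \<in> Q} \<in> rels k"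
    using assms(2,3) Cons.prems by (auto simp: rels_def)
  note from_runs = arcs_from_runs[OF assms(3) xz(1) this]
  have set_eq: "R \<union> {x. (x, a) \<in> set (p # ps)} \<times> {y. (b, y) \<in> Q} =
     (if z = a then (R \<union> {x. (x, a) \<in> set ps} \<times> {y. (b, y) \<in> Q}) \<union> {x} \<times> {y. (b, y) \<in> Q}
      else R \<union> {x. (x, a) \<in> set ps} \<times> {y. (b, y) \<in> Q})"
    by (auto simp: p)
  have "20 * nodes (enc_nat z) \<le> 20 * B"
    using xz nodes_label by auto
  moreover have "B \<le> B ^ 6"
    using pow_mono[of 1 6] by simp
  ultimately show ?case
    using eq_runs[of "enc_nat z" "enc_nat a"] Cons from_runs[of b]
      pow_Suc_ge[of 6] pow_large[of 6] unfolding set_eq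
    by (intro runsI)
      (auto simp: body_defs ok_simps runs_def p enc_pair_def enc_bool_def)
qed

lemma op_rel_runs:
  assumes "R \<in> rels k" "a \<in> {1..k}" "b \<in> {1..k}"
  shows "does op_rel_fn [enc_bool g, enc_nat a, enc_nat b, enc_rel R] (enc_rel (op_rel g a b R))
    (B ^ 9)"
proof -
  obtain ps where ps: "enc_rel R = lst (map enc_pair ps)" "set ps = R" "length ps < B"
    using assms(1) by (rule rel_list)
  have "does arcs_fn [enc_nat a, enc_nat b, enc_rel R, enc_rel R, enc_rel R]
      (enc_rel (arcs_rel a b R)) (B ^ 8)"
    using runs_loop[OF arcs_runs_list[of ps R R a b] ps(3)] assms ps
    by (simp add: rels_def arcs_rel_def)
  then show ?thesis
    using relabel_runs[OF assms] pow_Suc_ge[of 8] pow_large[of 8] pow_mono[of 6 8]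
    by (intro runsI) (auto simp: body_defs ok_simps runs_def op_rel_def enc_bool_def)
qed

section \<open>Unary operations on states and tables\<close>

lemma op_state_runs_list:
  assumes "set Rs \<subseteq> rels k" "length Rs \<le> r" "a \<in> {1..k}" "b \<in> {1..k}"
  shows "does op_state_fn [enc_bool g, enc_nat a, enc_nat b, lst (map enc_rel Rs)]
    (enc_state (image_mset (op_rel g a b) (mset Rs))) ((length Rs + 1) * B ^ 10)"
  using assms(1,2)
proof (induction Rs)
  case Nil
  show ?case
    using pow_large[of 10]
    by (intro runsI) (simp_all add: body_defs ok_simps)
next
  case (Cons R Rs)
  have "R \<in> rels k"
    using Cons.prems by simp
  moreover have "op_rel g a b R \<in> rels k"
    using op_rel_in_rels[OF \<open>R \<in> rels k\<close> assms(3,4)] .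
  ultimately show ?case
    using Cons op_rel_runs[of R a b g] assms(3,4) pow_Suc_ge[of 9] pow_large[of 9] pow_mono[of 4 9]
      ins_state_runs[of "op_rel g a b R" "image_mset (op_rel g a b) (mset Rs)"]
    by (intro runsI) (simp_all add: body_defs ok_simps runs_def)
qed

lemma op_state_runs:
  assumes "M \<in> states k r" "a \<in> {1..k}" "b \<in> {1..k}"
  shows "does op_state_fn [enc_bool g, enc_nat a, enc_nat b, enc_state M]
    (enc_state (image_mset (op_rel g a b) M)) (B ^ 11)"
proof -
  obtain Rs where Rs: "enc_state M = lst (map enc_rel Rs)" "mset Rs = M"
    by (rule state_list)
  have "set Rs \<subseteq> rels k" "length Rs = r"
    using assms(1) by (auto simp: states_def Rs(2)[symmetric])
  then show ?thesis
    using runs_loop[OF op_state_runs_list[of Rs a b g]] assms r Rs by simp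
qed

lemma closes_cycle_runs_list:
  assumes "set Rs \<subseteq> rels k" "a \<in> {1..k}" "b \<in> {1..k}"
  shows "does closes_cycle_fn [enc_nat a, enc_nat b, lst (map enc_rel Rs)]
    (enc_bool (\<exists>R\<in>set Rs. (b, a) \<in> R)) ((length Rs + 1) * B ^ 4)"
  using assms(1)
proof (induction Rs)
  case Nil
  show ?case
    using pow_large[of 4]
    by (intro runsI) (simp_all add: body_defs ok_simps enc_bool_def)
next
  case (Cons R Rs)
  obtain ps where ps: "enc_rel R = lst (map enc_pair ps)" "set ps = R" "length ps < B"
    using Cons.prems rel_list[of R] by auto
  have "does member_fn [enc_pair (b, a), enc_rel R] (enc_bool ((b, a) \<in> R)) (B ^ 3)"
    using runs_loop[OF member_runs[of "enc_pair (b, a)" "map enc_pair ps"]] nodes_pair[of b a]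
      assms ps
    by (simp add: image_iff)
  then show ?case
    using Cons pow_Suc_ge[of 3] pow_large[of 3]
    by (intro runsI) (auto simp: body_defs ok_simps runs_def enc_bool_def enc_pair_def
      split: if_splits)
qed

lemma closes_cycle_runs:
  assumes "M \<in> states k r" "a \<in> {1..k}" "b \<in> {1..k}"
  shows "does closes_cycle_fn [enc_nat a, enc_nat b, enc_state M]
    (enc_bool (\<exists>R\<in>#M. (b, a) \<in> R)) (B ^ 5)"
proof -
  obtain Rs where Rs: "enc_state M = lst (map enc_rel Rs)" "mset Rs = M"
    by (rule state_list)
  have *: "set Rs \<subseteq> rels k" "length Rs = r"
    using assms(1) by (auto simp: states_def Rs(2)[symmetric])
  then show ?thesis
    using runs_loop[OF closes_cycle_runs_list[of Rs a b]] assms r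
    by (simp add: Rs(1)) (simp add: Rs(2)[symmetric])
qed

lemma op_state_in_states:
  assumes "M \<in> states k r" "a \<in> {1..k}" "b \<in> {1..k}"
  shows "image_mset (op_rel g a b) M \<in> states k r"
  using assms op_rel_in_rels by (auto simp: states_def)

lemma op_table_subset:
  "T \<subseteq> states k r \<Longrightarrow> a \<in> {1..k} \<Longrightarrow> b \<in> {1..k} \<Longrightarrow> op_table g a b T \<subseteq> states k r"
  using op_state_in_states unfolding op_table_def by blast

lemma op_table_insert:
  "op_table g a b (insert M T) = (if g \<or> \<not> (\<exists>R\<in>#M. (b, a) \<in> R)
     then insert (image_mset (op_rel g a b) M) (op_table g a b T) else op_table g a b T)"
  by (auto simp: op_table_def)

lemma op_table_runs_list:
  assumes "set Ms \<subseteq> states k r" "a \<in> {1..k}" "b \<in> {1..k}"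
  shows "does op_table_fn [enc_bool g, enc_nat a, enc_nat b, lst (map enc_state Ms)]
    (set_tree (enc_state ` op_table g a b (set Ms))) ((length Ms + 1) * B ^ 12)"
  using assms(1)
proof (induction Ms)
  case Nil
  show ?case
    using pow_large[of 12]
    by (intro runsI) (simp_all add: body_defs ok_simps op_table_def)
next
  case (Cons M Ms)
  have M: "M \<in> states k r"
    using Cons.prems by simp
  have sub: "op_table g a b (set Ms) \<subseteq> states k r"
    using Cons.prems op_table_subset assms by simp
  show ?case
    using Cons op_state_runs[OF M assms(2,3), of g] closes_cycle_runs[OF M assms(2,3)]
      ins_table_runs[OF sub op_state_in_states[OF M assms(2,3), of g]]
      pow_Suc_ge[of 11] pow_large[of 11] pow_mono[of 4 11] pow_mono[of 5 11]
    unfolding list.set op_table_insert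
    by (cases g; cases "\<exists>R\<in>#M. (b, a) \<in> R"; intro runsI)
      (simp_all add: body_defs ok_simps runs_def enc_bool_def del: Bex_set Ball_set bex_simps
        ball_simps)
qed

lemma op_table_runs:
  assumes "T \<subseteq> states k r" "a \<in> {1..k}" "b \<in> {1..k}"
  shows "does op_table_fn [enc_bool g, enc_nat a, enc_nat b, set_tree (enc_state ` T)]
    (set_tree (enc_state ` op_table g a b T)) (B ^ 13)"
proof -
  obtain Ms where Ms: "set_tree (enc_state ` T) = lst (map enc_state Ms)" "set Ms = T"
    "length Ms < B"
    using assms(1) by (rule table_list)
  then show ?thesis
    using runs_loop[OF op_table_runs_list[of Ms a b g]] assms by simp
qed

section \<open>Merging the tables of a disjoint union\<close>

lemma pick_runs:
  assumes "R \<in> rels k" "set Qs \<subseteq> rels k" "(P + mset Qs, N) \<in> merges k r" "S \<subseteq> merges k r"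
  shows "does pick_fn [enc_rel R, enc_state P, lst (map enc_rel Qs), enc_state N,
    set_tree (enc_merge ` S)]
    (set_tree (enc_merge ` ((\<lambda>Q. (P + mset Qs - {#Q#}, add_mset (R \<union> Q) N)) ` set Qs \<union> S)))
    ((length Qs + 1) * B ^ 7)"
  using assms(2,3)
proof (induction Qs arbitrary: P)
  case Nil
  show ?case
    using pow_large[of 7]
    by (intro runsI) (simp_all add: body_defs ok_simps)
next
  case (Cons Q Qs)
  \<comment> \<open>The result after \<open>Q\<close> has been skipped. Skipping moves
    \<open>Q\<close> from the list into \<open>P\<close>, so that \<open>P\<close> and the list
    together remain the free classes; this is why the induction generalises
    \<open>P\<close>.\<close>
  let ?S = "(\<lambda>Q'. (add_mset Q P + mset Qs - {#Q'#}, add_mset (R \<union> Q') N)) ` set Qs \<union> S"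
  have Q: "Q \<in> rels k" "set Qs \<subseteq> rels k"
    using Cons.prems by auto
  have sz: "size P + Suc (length Qs) + size N = r" "set_mset P \<subseteq> rels k" "set_mset N \<subseteq> rels k"
    using Cons.prems(2) by (auto simp: merges_def)
  have new: "(P + mset Qs, add_mset (R \<union> Q) N) \<in> merges k r"
    using sz Q assms(1) by (auto simp: merges_def)
  have sub: "?S \<subseteq> merges k r"
  proof -
    have "?S \<subseteq> step_merges R {(P + mset (Q # Qs), N)} \<union> S"
      by (auto simp: step_merges_def)
    also have "\<dots> \<subseteq> merges k r"
      using step_merges_subset[OF assms(1), of "{(P + mset (Q # Qs), N)}"] Cons.prems(2) assms(4)
        by auto
    finally show ?thesis .
  qed
  have IH: "does pick_fn [enc_rel R, enc_state (add_mset Q P), lst (map enc_rel Qs), enc_state N,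
      set_tree (enc_merge ` S)] (set_tree (enc_merge ` ?S)) ((length Qs + 1) * B ^ 7)"
    using Cons.IH[of "add_mset Q P"] Cons.prems by simp
  have eq: "(\<lambda>Q'. (P + mset (Q # Qs) - {#Q'#}, add_mset (R \<union> Q') N)) ` set (Q # Qs) \<union> S =
      insert (P + mset Qs, add_mset (R \<union> Q) N) ?S"
    by simp
  \<comment> \<open>\<open>Q\<close> itself is one of the \<open>r\<close> classes, which leaves
    room for inserting one more relation into \<open>N\<close> or \<open>P\<close>.\<close>
  have "size N < r" "size P < r" "length Qs + size P \<le> r"
    using sz by auto
  then show ?case
    using IH ins_merge_runs[OF sub new] union_state_runs[OF Q(2),
      of P] union_rel_runs[OF assms(1) Q(1)]
      ins_state_runs[of "R \<union> Q" N] ins_state_runs[of Q P] Q(1) assms(1)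
      pow_Suc_ge[of 6] pow_large[of 6] pow_mono[of 4 6]
    unfolding eq
    by (intro runsI) (simp_all add: body_defs ok_simps runs_def add.commute)
qed

lemma step_runs_list:
  assumes "R \<in> rels k" "set Ss \<subseteq> merges k r"
  shows "does step_fn [enc_rel R, lst (map enc_merge Ss)]
    (set_tree (enc_merge ` step_merges R (set Ss))) ((length Ss + 1) * B ^ 9)"
  using assms(2)
proof (induction Ss)
  case Nil
  show ?case
    using pow_large[of 9]
    by (intro runsI) (simp_all add: body_defs ok_simps step_merges_def)
next
  case (Cons p Ss)
  obtain M N where p: "p = (M, N)"
    by (cases p)
  obtain Qs where Qs: "enc_state M = lst (map enc_rel Qs)" "mset Qs = M"
    by (rule state_list)
  have "(mset Qs, N) \<in> merges k r"
    using Cons.prems p Qs by simp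
  then have "set Qs \<subseteq> rels k" "length Qs \<le> r"
    by (auto simp: merges_def)
  then have "does pick_fn [enc_rel R, Leaf, enc_state M, enc_state N,
    set_tree (enc_merge ` step_merges R (set Ss))]
      (set_tree (enc_merge ` ((\<lambda>Q. (M - {#Q#}, add_mset (R \<union> Q) N)) ` set_mset M \<union>
        step_merges R (set Ss)))) (B ^ 8)"
    using runs_loop[OF pick_runs[of R Qs "{#}" N "step_merges R (set Ss)"]]
      step_merges_subset[OF assms(1), of "set Ss" r] \<open>(mset Qs, N) \<in> merges k r\<close> Cons.prems
        assms(1) r Qs(1)
    by (simp add: Qs(2)[symmetric])
  moreover have "step_merges R (set (p # Ss)) =
      (\<lambda>Q. (M - {#Q#}, add_mset (R \<union> Q) N)) ` set_mset M \<union> step_merges R (set Ss)"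
    by (simp add: step_merges_def p)
  ultimately show ?case
    using Cons pow_Suc_ge[of 8] pow_large[of 8]
    by (intro runsI) (simp_all add: body_defs ok_simps runs_def p enc_merge_def)
qed

lemma step_runs:
  assumes "R \<in> rels k" "S \<subseteq> merges k r"
  shows "does step_fn [enc_rel R, set_tree (enc_merge ` S)]
    (set_tree (enc_merge ` step_merges R S)) (B ^ 10)"
proof -
  obtain Ss where Ss: "set_tree (enc_merge ` S) = lst (map enc_merge Ss)" "set Ss = S"
    "length Ss < B"
    using assms(2) by (rule merge_list)
  then show ?thesis
    using runs_loop[OF step_runs_list[of R Ss]] assms by simp
qed

lemma fold_step_merges_subset:
  "set Rs \<subseteq> rels k \<Longrightarrow> S \<subseteq> merges k r \<Longrightarrow> fold step_merges Rs S \<subseteq> merges k r"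
  by (induction Rs arbitrary: S) (auto simp: step_merges_subset)

lemma steps_runs_list:
  assumes "set Rs \<subseteq> rels k" "S \<subseteq> merges k r"
  shows "does steps_fn [lst (map enc_rel Rs), set_tree (enc_merge ` S)]
    (set_tree (enc_merge ` fold step_merges Rs S)) ((length Rs + 1) * B ^ 11)"
  using assms
proof (induction Rs arbitrary: S)
  case Nil
  show ?case
    using pow_large[of 11]
    by (intro runsI) (simp_all add: body_defs ok_simps)
next
  case (Cons R Rs)
  then have "step_merges R S \<subseteq> merges k r"
    by (simp add: step_merges_subset)
  from Cons.IH[OF _ this] Cons.prems show ?case
    using step_runs[of R S] pow_Suc_ge[of 10] pow_large[of 10]
    by (intro runsI) (simp_all add: body_defs ok_simps runs_def)
qed

lemma start_runs_list:
  assumes "set Ms \<subseteq> states k r"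
  shows "does start_fn [lst (map enc_state Ms)]
    (set_tree (enc_merge ` (\<lambda>M. (M, {#})) ` set Ms)) ((length Ms + 1) * B ^ 5)"
  using assms
proof (induction Ms)
  case Nil
  show ?case
    using pow_large[of 5]
    by (intro runsI) (simp_all add: body_defs ok_simps)
next
  case (Cons M Ms)
  have "(\<lambda>M. (M, {#})) ` set Ms \<subseteq> merges k r" "(M, {#}) \<in> merges k r"
    using Cons.prems state_imp_merge by auto
  with ins_merge_runs[of "(\<lambda>M. (M, {#})) ` set Ms" M "{#}"] Cons show ?case
    using pow_Suc_ge[of 4] pow_large[of 4]
    by (intro runsI) (simp_all add: body_defs ok_simps runs_def)
qed

lemma finish_runs_list:
  assumes "snd ` set Ss \<subseteq> states k r" "T \<subseteq> states k r"
  shows "does finish_fn [lst (map enc_merge Ss), set_tree (enc_state ` T)]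
    (set_tree (enc_state ` (snd ` set Ss \<union> T))) ((length Ss + 1) * B ^ 5)"
  using assms(1)
proof (induction Ss)
  case Nil
  show ?case
    using pow_large[of 5]
    by (intro runsI) (simp_all add: body_defs ok_simps)
next
  case (Cons p Ss)
  have "snd ` set Ss \<union> T \<subseteq> states k r" "snd p \<in> states k r"
    using Cons.prems assms(2) by auto
  with ins_table_runs[of "snd ` set Ss \<union> T" "snd p"] Cons show ?case
    using pow_Suc_ge[of 4] pow_large[of 4]
    by (intro runsI) (simp_all add: body_defs ok_simps runs_def enc_merge_def)
qed

lemma steps_runs:
  assumes "M \<in> states k r" "T \<subseteq> states k r"
  obtains Rs where "mset Rs = M"
    "does steps_fn [enc_state M, set_tree (enc_merge ` (\<lambda>M. (M, {#})) ` T)]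
    (set_tree (enc_merge ` fold step_merges Rs ((\<lambda>M. (M, {#})) ` T))) (B ^ 12)"
proof -
  obtain Rs where Rs: "enc_state M = lst (map enc_rel Rs)" "mset Rs = M"
    by (rule state_list)
  have *: "set Rs \<subseteq> rels k" "length Rs = r"
    using assms(1) by (auto simp: states_def Rs(2)[symmetric])
  have "(\<lambda>M. (M, {#})) ` T \<subseteq> merges k r"
    using assms(2) state_imp_merge by blast
  from runs_loop[OF steps_runs_list[OF *(1) this]] *(2) r Rs that show ?thesis
    by simp
qed

lemma start_runs:
  assumes "T \<subseteq> states k r"
  shows "does start_fn [set_tree (enc_state ` T)]
    (set_tree (enc_merge ` (\<lambda>M. (M, {#})) ` T)) (B ^ 6)"
proof -
  obtain Ms where Ms: "set_tree (enc_state ` T) = lst (map enc_state Ms)" "set Ms = T"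
    "length Ms < B"
    using assms by (rule table_list)
  then show ?thesis
    using runs_loop[OF start_runs_list[of Ms]] assms by simp
qed

lemma finish_runs:
  assumes "S \<subseteq> merges k r" "snd ` S \<subseteq> states k r" "T \<subseteq> states k r"
  shows "does finish_fn [set_tree (enc_merge ` S), set_tree (enc_state ` T)]
    (set_tree (enc_state ` (snd ` S \<union> T))) (B ^ 6)"
proof -
  obtain Ss where Ss: "set_tree (enc_merge ` S) = lst (map enc_merge Ss)" "set Ss = S"
    "length Ss < B"
    using assms(1) by (rule merge_list)
  then show ?thesis
    using runs_loop[OF finish_runs_list[of Ss T]] assms by simp
qed

end

text \<open>\<open>Z\<close> records which partner each class of \<open>Rs\<close> has chosen; the
  partners have to form a submultiset of the free classes. The right-hand side depends on
  \<open>Rs\<close> only through \<open>mset Rs\<close>, so the order in which an encoded state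
  lists its classes is irrelevant.\<close>

lemma fold_step_merges:
  "fold step_merges Rs S = {(M - image_mset snd Z, N + image_mset (\<lambda>(x, y). x \<union> y) Z) |M N Z.
     (M, N) \<in> S \<and> image_mset fst Z = mset Rs \<and> image_mset snd Z \<subseteq># M}"
proof (induction Rs arbitrary: S)
  case Nil
  show ?case
    by auto
next
  case (Cons R Rs)
  show ?case (is "?L = ?R")
  proof (intro equalityI subsetI)
    fix p assume "p \<in> ?L"
    then obtain M N Z where p: "p = (M - image_mset snd Z, N + image_mset (\<lambda>(x, y). x \<union> y) Z)"
      "(M, N) \<in> step_merges R S" "image_mset fst Z = mset Rs" "image_mset snd Z \<subseteq># M"
      by (auto simp: Cons.IH)
    then obtain M' N' Q where q: "(M', N') \<in> S" "Q \<in># M'" "M = M' - {#Q#}" "N = add_mset (R \<union> Q) N'"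
      by (auto simp: step_merges_def)
    have "image_mset snd (add_mset (R, Q) Z) \<subseteq># M'"
      using p(4) q(2,3) by (simp add: insert_subset_eq_iff)
    moreover have "p = (M' - image_mset snd (add_mset (R, Q) Z),
        N' + image_mset (\<lambda>(x, y). x \<union> y) (add_mset (R, Q) Z))"
      using p(1) q(3,4) by simp
    moreover have "image_mset fst (add_mset (R, Q) Z) = mset (R # Rs)"
      using p(3) by simp
    ultimately show "p \<in> ?R"
      using q(1) by blast
  next
    fix p assume "p \<in> ?R"
    then obtain M N Z where p: "p = (M - image_mset snd Z, N + image_mset (\<lambda>(x, y). x \<union> y) Z)"
      "(M, N) \<in> S" "image_mset fst Z = add_mset R (mset Rs)" "image_mset snd Z \<subseteq># M"
      by auto
    obtain z Z' where Z: "Z = add_mset z Z'" "fst z = R" "image_mset fst Z' = mset Rs"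
      using msed_map_invR[OF p(3)] by auto
    let ?M = "M - {#snd z#}" and ?N = "add_mset (R \<union> snd z) N"
    have z: "snd z \<in># M" "image_mset snd Z' \<subseteq># ?M"
      using p(4) Z(1) by (simp_all add: insert_subset_eq_iff)
    have "(?M, ?N) \<in> step_merges R S"
      using p(2) z(1) by (force simp: step_merges_def)
    moreover have "p = (?M - image_mset snd Z', ?N + image_mset (\<lambda>(x, y). x \<union> y) Z')"
      using p(1) Z(1,2) by (cases z) simp
    ultimately show "p \<in> ?L"
      using Z(3) z(2) unfolding fold_simps Cons.IH by blast
  qed
qed

text \<open>Both states have exactly \<open>r\<close> classes, so the chosen partners, a submultiset
  of \<open>M\<close> of the same size, exhaust \<open>M\<close>: no free class is left, and the
  second components are complete states.\<close>

lemma snd_fold_step_merges: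
  assumes "mset Rs \<in> states k r" "T \<subseteq> states k r"
  shows "snd ` fold step_merges Rs ((\<lambda>M. (M, {#})) ` T) = merge_tables {mset Rs} T" (is "?L = ?R")
proof (intro equalityI subsetI)
  fix N assume "N \<in> ?L"
  then obtain M Z where *: "M \<in> T" "image_mset fst Z = mset Rs" "image_mset snd Z \<subseteq># M"
    "N = image_mset (\<lambda>(x, y). x \<union> y) Z"
    by (auto simp: fold_step_merges)
  have "size Z = r"
    using assms(1) arg_cong[OF *(2), of size] by (auto simp: states_def)
  moreover have "size M = r"
    using *(1) assms(2) by (auto simp: states_def)
  ultimately have "image_mset snd Z = M"
    using *(3) by (auto simp: mset_subset_eq_exists_conv)
  then show "N \<in> ?R"
    using * by (auto simp: merge_tables_def)
next
  fix N assume "N \<in> ?R"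
  then obtain Z where *: "image_mset fst Z = mset Rs" "image_mset snd Z \<in> T"
    "N = image_mset (\<lambda>(x, y). x \<union> y) Z"
    by (auto simp: merge_tables_def)
  then have "({#}, N) \<in> fold step_merges Rs ((\<lambda>M. (M, {#})) ` T)"
    unfolding fold_step_merges by force
  then show "N \<in> ?L"
    by force
qed

lemma merge_tables_subset:
  assumes "S \<subseteq> states k r" "T \<subseteq> states k r"
  shows "merge_tables S T \<subseteq> states k r"
proof
  fix N assume "N \<in> merge_tables S T"
  then obtain Z where *: "image_mset fst Z \<in> S" "image_mset snd Z \<in> T"
    "N = image_mset (\<lambda>(x, y). x \<union> y) Z"
    by (auto simp: merge_tables_def)
  then have Z: "image_mset fst Z \<in> states k r" "image_mset snd Z \<in> states k r"
    using assms by auto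
  have "x \<union> y \<in> rels k" if "(x, y) \<in># Z" for x y
  proof (rule rels_Un)
    show "x \<in> rels k" "y \<in> rels k"
      using that Z image_eqI[of x fst "(x, y)" "set_mset Z"] image_eqI[of y snd "(x, y)"
        "set_mset Z"]
      by (auto simp: states_def simp del: set_image_mset split_paired_All)
        (auto simp: set_image_mset subset_iff)
  qed
  with Z show "N \<in> states k r"
    by (auto simp: *(3) states_def)
qed

context universe
begin

lemma product_runs_list:
  assumes "set Ms \<subseteq> states k r" "T \<subseteq> states k r"
  shows "does product_fn [lst (map enc_state Ms), set_tree (enc_state ` T)]
    (set_tree (enc_state ` merge_tables (set Ms) T)) ((length Ms + 1) * B ^ 13)"
  using assms(1)
proof (induction Ms)
  case Nil
  show ?case
    using pow_large[of 13]
    by (intro runsI) (simp_all add: body_defs ok_simps merge_tables_def)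
next
  case (Cons M Ms)
  have M: "M \<in> states k r" and Ms: "set Ms \<subseteq> states k r"
    using Cons.prems by auto
  obtain Rs where Rs: "mset Rs = M"
    "does steps_fn [enc_state M, set_tree (enc_merge ` (\<lambda>M. (M, {#})) ` T)]
      (set_tree (enc_merge ` fold step_merges Rs ((\<lambda>M. (M, {#})) ` T))) (B ^ 12)"
    using M assms(2) by (rule steps_runs)
  let ?S = "fold step_merges Rs ((\<lambda>M. (M, {#})) ` T)"
  have snd: "snd ` ?S = merge_tables {M} T"
    using snd_fold_step_merges[of Rs k r T] M assms(2) Rs(1) by simp
  have "set Rs \<subseteq> rels k"
    using M by (auto simp: states_def Rs(1)[symmetric])
  moreover have "(\<lambda>M. (M, {#})) ` T \<subseteq> merges k r"
    using assms(2) state_imp_merge by blast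
  ultimately have sub: "?S \<subseteq> merges k r"
    by (rule fold_step_merges_subset)
  have "snd ` ?S \<subseteq> states k r"
    unfolding snd using M assms(2) by (intro merge_tables_subset) auto
  note finish = finish_runs[OF sub this merge_tables_subset[OF Ms assms(2)]]
  have eq: "merge_tables (set (M # Ms)) T = snd ` ?S \<union> merge_tables (set Ms) T"
    unfolding snd by (auto simp: merge_tables_def)
  show ?case
    using Cons Rs(2) finish start_runs[OF assms(2)]
      pow_Suc_ge[of 12] pow_large[of 12] pow_mono[of 6 12] unfolding eq
    by (intro runsI) (simp_all add: body_defs ok_simps runs_def)
qed

lemma product_runs:
  assumes "S \<subseteq> states k r" "T \<subseteq> states k r"
  shows "does product_fn [set_tree (enc_state ` S), set_tree (enc_state ` T)]
    (set_tree (enc_state ` merge_tables S T)) (B ^ 14)"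
proof -
  obtain Ms where Ms: "set_tree (enc_state ` S) = lst (map enc_state Ms)" "set Ms = S"
    "length Ms < B"
    using assms(1) by (rule table_list)
  then show ?thesis
    using runs_loop[OF product_runs_list[of Ms T]] assms by simp
qed

lemma pad_runs:
  assumes "R \<in> rels k" "n < r"
  shows "does pad_fn [enc_state {#R#}, enc_nat n] (enc_state (add_mset R (replicate_mset n {})))
    ((n + 1) * B ^ 5)"
  using assms(2)
proof (induction n)
  case 0
  show ?case
    using pow_large[of 5]
    by (intro runsI) (simp_all add: body_defs ok_simps)
next
  case (Suc n)
  have "{} \<in> rels k"
    by (simp add: rels_def)
  from ins_state_runs[OF this, of "add_mset R (replicate_mset n {})"] Suc show ?case
    using pow_Suc_ge[of 4] pow_large[of 4]
    by (intro runsI) (simp_all add: body_defs ok_simps runs_def add_mset_commute)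
qed

end

section \<open>Colourings and their states\<close>

lemma dcw_arcs_subset: "dcw_arcs X \<subseteq> dcw_verts X \<times> dcw_verts X"
  by (induction X) auto

lemma finite_dcw_verts [simp]: "finite (dcw_verts X)"
  by (induction X) auto

lemma dcw_label_bounds: "dcw_k_exp k X \<Longrightarrow> u \<in> dcw_verts X \<Longrightarrow> dcw_label X u \<in> {1..k}"
  by (induction X) auto

definition class_arcs :: "dcw_exp \<Rightarrow> nat set \<Rightarrow> (nat \<times> nat) set" where
  "class_arcs X S = dcw_arcs X \<inter> S \<times> S"

text \<open>With the reflexive closure, \<open>(a, a)\<close> belongs to the relation whenever label
  \<open>a\<close> occurs in the class. Presence of labels thus needs no separate record.\<close>

definition class_rel :: "dcw_exp \<Rightarrow> nat set \<Rightarrow> (nat \<times> nat) set" where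
  "class_rel X S =
     {(dcw_label X u, dcw_label X v) |u v. u \<in> S \<and> v \<in> S \<and> (u, v) \<in> (class_arcs X S)\<^sup>*}"

definition color_class :: "dcw_exp \<Rightarrow> (nat \<Rightarrow> nat) \<Rightarrow> nat \<Rightarrow> nat set" where
  "color_class X c i = {v \<in> dcw_verts X. c v = i}"

definition acyclic_coloring :: "nat \<Rightarrow> dcw_exp \<Rightarrow> (nat \<Rightarrow> nat) \<Rightarrow> bool" where
  "acyclic_coloring r X c \<longleftrightarrow> (\<forall>v\<in>dcw_verts X. c v < r) \<and>
     (\<forall>i<r. acyclic (class_arcs X (color_class X c i)))"

definition coloring_state :: "nat \<Rightarrow> dcw_exp \<Rightarrow> (nat \<Rightarrow> nat) \<Rightarrow> (nat \<times> nat) set multiset" where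
  "coloring_state r X c = image_mset (\<lambda>i. class_rel X (color_class X c i)) (mset_set {..<r})"

definition state_table :: "nat \<Rightarrow> dcw_exp \<Rightarrow> (nat \<times> nat) set multiset set" where
  "state_table r X = {coloring_state r X c |c. acyclic_coloring r X c}"

lemma color_class_subset: "color_class X c i \<subseteq> dcw_verts X"
  by (auto simp: color_class_def)

lemma class_rel_in_rels: "dcw_k_exp k X \<Longrightarrow> S \<subseteq> dcw_verts X \<Longrightarrow> class_rel X S \<in> rels k"
  using dcw_label_bounds unfolding class_rel_def rels_def by blast

lemma state_table_subset: "dcw_k_exp k X \<Longrightarrow> state_table r X \<subseteq> states k r"
  using class_rel_in_rels[OF _ color_class_subset]
  by (auto simp: state_table_def coloring_state_def states_def)

lemma state_table_Vertex:
  assumes "1 \<le> r"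
  shows "state_table r (Vertex a v) = {add_mset {(a, a)} (replicate_mset (r - 1) {})}"
proof -
  have state: "coloring_state r (Vertex a v) c = add_mset {(a, a)} (replicate_mset (r - 1) {})"
    if c: "c v < r" for c
  proof -
    have rest: "image_mset (\<lambda>i. class_rel (Vertex a v) (color_class (Vertex a v) c i))
      (mset_set ({..<r} - {c v}))
        = image_mset (\<lambda>i. {}) (mset_set ({..<r} - {c v}))"
      by (intro image_mset_cong) (auto simp: color_class_def class_rel_def)
    have own: "class_rel (Vertex a v) (color_class (Vertex a v) c (c v)) = {(a, a)}"
      by (auto simp: color_class_def class_rel_def)
    have split: "mset_set {..<r} = add_mset (c v) (mset_set ({..<r} - {c v}))"
      using c by (intro mset_set.remove) auto
    show ?thesis
      unfolding coloring_state_def split image_mset_add_mset own rest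
      using c by (simp add: image_mset_const_eq)
  qed
  have zero: "acyclic_coloring r (Vertex a v) (\<lambda>_. 0)"
    using assms by (simp add: acyclic_coloring_def class_arcs_def acyclic_def)
  have "c v < r" if "acyclic_coloring r (Vertex a v) c" for c
    using that by (simp add: acyclic_coloring_def)
  then have "state_table r (Vertex a v) \<subseteq> {add_mset {(a, a)} (replicate_mset (r - 1) {})}"
    using state by (auto simp: state_table_def)
  moreover have "coloring_state r (Vertex a v) (\<lambda>_. 0) \<in> state_table r (Vertex a v)"
    unfolding state_table_def using zero by blast
  ultimately show ?thesis
    using state[of "\<lambda>_. 0"] assms by auto
qed

lemma image_pair_Collect:
  "(\<lambda>(x, y). h x y) ` {(l u, l v) |u v. P u v} = {h (l u) (l v) |u v. P u v}"
  by force

lemma state_table_Relabel: "state_table r (Relabel a b X) = op_table True a b (state_table r X)"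
proof -
  have rel: "class_rel (Relabel a b X) S = op_rel True a b (class_rel X S)" for S
    by (simp add: class_rel_def class_arcs_def op_rel_def relabel_rel_def image_pair_Collect)
  have "color_class (Relabel a b X) = color_class X" "class_arcs (Relabel a b X) = class_arcs X"
    by (auto simp: color_class_def class_arcs_def fun_eq_iff)
  then have "coloring_state r (Relabel a b X) c =
    image_mset (op_rel True a b) (coloring_state r X c)"
    "acyclic_coloring r (Relabel a b X) c = acyclic_coloring r X c" for c
    by (simp_all add: coloring_state_def acyclic_coloring_def rel multiset.map_comp o_def)
  then show ?thesis
    by (auto simp: state_table_def op_table_def)
qed

text \<open>A path uses the new arcs at most once, since otherwise it would close a cycle.\<close>

lemma rtrancl_Un_Times:
  assumes "\<And>u v. u \<in> A \<Longrightarrow> v \<in> B \<Longrightarrow> (v, u) \<notin> E\<^sup>*"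
  shows "(E \<union> A \<times> B)\<^sup>* = E\<^sup>* \<union> {(x, y). \<exists>u\<in>A. \<exists>v\<in>B. (x, u) \<in> E\<^sup>* \<and> (v, y) \<in> E\<^sup>*}"
    (is "?L = ?R")
proof (intro equalityI subsetI)
  fix p assume "p \<in> ?L"
  then have "(fst p, snd p) \<in> ?L"
    by simp
  then have "(fst p, snd p) \<in> ?R"
  proof (induction rule: rtrancl_induct)
    case (step y z)
    then show ?case
      using assms by (auto intro: rtrancl_into_rtrancl)
  qed simp
  then show "p \<in> ?R"
    by simp
next
  fix p assume p: "p \<in> ?R"
  have mono: "E\<^sup>* \<subseteq> ?L"
    by (rule rtrancl_mono) simp
  have new: "(u, v) \<in> ?L" if "u \<in> A" "v \<in> B" for u v
    using that by auto
  have "(x, y) \<in> ?L" if "u \<in> A" "v \<in> B" "(x, u) \<in> E\<^sup>*" "(v, y) \<in> E\<^sup>*" for x y u v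
    using that mono new by (meson rtrancl_trans subsetD)
  with p mono show "p \<in> ?L"
    by blast
qed

text \<open>Cut a cycle at one of its arcs. By \<open>rtrancl_Un_Times\<close> the remaining path
  uses the new arcs at most once, and in each case an old cycle or an old path from \<open>B\<close>
  back to \<open>A\<close> results.\<close>

lemma acyclic_Un_Times:
  "acyclic (E \<union> A \<times> B) \<longleftrightarrow> acyclic E \<and> (\<forall>u\<in>A. \<forall>v\<in>B. (v, u) \<notin> E\<^sup>*)"
proof (intro iffI conjI ballI notI)
  assume "acyclic (E \<union> A \<times> B)"
  then show "acyclic E"
    by (rule acyclic_subset) simp
  fix u v assume "u \<in> A" "v \<in> B" "(v, u) \<in> E\<^sup>*"
  then have "(u, v) \<in> E \<union> A \<times> B" "(v, u) \<in> (E \<union> A \<times> B)\<^sup>*"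
    using rtrancl_mono[of E "E \<union> A \<times> B"] by auto
  then have "(u, u) \<in> (E \<union> A \<times> B)\<^sup>+"
    by (rule rtrancl_into_trancl2)
  with \<open>acyclic (E \<union> A \<times> B)\<close> show False
    by (simp add: acyclic_def)
next
  assume E: "acyclic E \<and> (\<forall>u\<in>A. \<forall>v\<in>B. (v, u) \<notin> E\<^sup>*)"
  show "acyclic (E \<union> A \<times> B)"
    unfolding acyclic_def
  proof (intro allI notI)
    fix x assume "(x, x) \<in> (E \<union> A \<times> B)\<^sup>+"
    then obtain y where xy: "(x, y) \<in> E \<union> A \<times> B" and yx: "(y, x) \<in> (E \<union> A \<times> B)\<^sup>*"
      by (meson tranclD)
    have "(y, x) \<in> E\<^sup>* \<union> {(x, y). \<exists>u\<in>A. \<exists>v\<in>B. (x, u) \<in> E\<^sup>* \<and> (v, y) \<in> E\<^sup>*}"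
      using yx E rtrancl_Un_Times[of A B E] by simp
    then consider "(y, x) \<in> E\<^sup>*" | u v where "u \<in> A" "v \<in> B" "(y, u) \<in> E\<^sup>*" "(v, x) \<in> E\<^sup>*"
      by auto
    then show False
    proof cases
      case 1
      then have "(x, y) \<notin> E"
        using E rtrancl_into_trancl2[of x y E x] by (auto simp: acyclic_def)
      with 1 xy E show False
        by auto
    next
      case 2
      then have "(v, u) \<in> E\<^sup>*" if "(x, y) \<in> E"
        using that by (meson converse_rtrancl_into_rtrancl rtrancl_trans)
      with 2 xy E show False
        by auto
    qed
  qed
qed

lemma class_arcs_AddArcs:
  assumes "S \<subseteq> dcw_verts X"
  shows "class_arcs (AddArcs a b X) S =
    class_arcs X S \<union> {u \<in> S. dcw_label X u = a} \<times> {v \<in> S. dcw_label X v = b}"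
  using assms by (auto simp: class_arcs_def)

lemma acyclic_class_AddArcs:
  assumes "S \<subseteq> dcw_verts X"
  shows "acyclic (class_arcs (AddArcs a b X) S) \<longleftrightarrow>
    acyclic (class_arcs X S) \<and> (b, a) \<notin> class_rel X S"
  unfolding class_arcs_AddArcs[OF assms] acyclic_Un_Times by (auto simp: class_rel_def)

lemma class_rel_AddArcs:
  assumes "S \<subseteq> dcw_verts X" "(b, a) \<notin> class_rel X S"
  shows "class_rel (AddArcs a b X) S = arcs_rel a b (class_rel X S)"
proof -
  let ?A = "{u \<in> S. dcw_label X u = a}" and ?B = "{v \<in> S. dcw_label X v = b}"
  have star: "(class_arcs (AddArcs a b X) S)\<^sup>* = (class_arcs X S)\<^sup>* \<union>
      {(x, y). \<exists>u\<in>?A. \<exists>v\<in>?B. (x, u) \<in> (class_arcs X S)\<^sup>* \<and> (v, y) \<in> (class_arcs X S)\<^sup>*}"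
    unfolding class_arcs_AddArcs[OF assms(1)]
    by (rule rtrancl_Un_Times) (use assms(2) in \<open>auto simp: class_rel_def\<close>)
  let ?l = "dcw_label X"
  have mem: "(p, q) \<in> class_rel X S \<longleftrightarrow>
      (\<exists>u\<in>S. \<exists>v\<in>S. p = ?l u \<and> q = ?l v \<and> (u, v) \<in> (class_arcs X S)\<^sup>*)" for p q
    by (auto simp: class_rel_def)
  have mem': "(p, q) \<in> class_rel (AddArcs a b X) S \<longleftrightarrow> (\<exists>u\<in>S. \<exists>v\<in>S. p = ?l u \<and> q = ?l v \<and>
      ((u, v) \<in> (class_arcs X S)\<^sup>* \<or> (\<exists>x\<in>?A. \<exists>y\<in>?B.
        (u, x) \<in> (class_arcs X S)\<^sup>* \<and> (y, v) \<in> (class_arcs X S)\<^sup>*)))" for p q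
    unfolding class_rel_def star by auto
  have "(p, q) \<in> class_rel (AddArcs a b X) S \<longleftrightarrow> (p, q) \<in> arcs_rel a b (class_rel X S)" for p q
    unfolding arcs_rel_def Un_iff mem_Sigma_iff mem_Collect_eq mem mem' by blast
  then show ?thesis
    by auto
qed

lemma state_table_AddArcs: "state_table r (AddArcs a b X) = op_table False a b (state_table r X)"
proof -
  have cls: "color_class (AddArcs a b X) = color_class X"
    by (auto simp: color_class_def fun_eq_iff)
  have col: "acyclic_coloring r (AddArcs a b X) c \<longleftrightarrow>
      acyclic_coloring r X c \<and> (\<forall>R\<in>#coloring_state r X c. (b, a) \<notin> R)" for c
    by (auto simp: acyclic_coloring_def coloring_state_def cls
        acyclic_class_AddArcs[OF color_class_subset])
  have state: "coloring_state r (AddArcs a b X) c =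
    image_mset (op_rel False a b) (coloring_state r X c)"
    if "\<forall>R\<in>#coloring_state r X c. (b, a) \<notin> R" for c
    using that unfolding coloring_state_def multiset.map_comp cls o_def op_rel_def
    by (intro image_mset_cong) (simp add: class_rel_AddArcs[OF color_class_subset])
  have "state_table r (AddArcs a b X) = {coloring_state r (AddArcs a b X) c |c.
      acyclic_coloring r X c \<and> (\<forall>R\<in>#coloring_state r X c. (b, a) \<notin> R)}"
    by (simp add: state_table_def col)
  also have "\<dots> = {image_mset (op_rel False a b) (coloring_state r X c) |c.
      acyclic_coloring r X c \<and> (\<forall>R\<in>#coloring_state r X c. (b, a) \<notin> R)}"
    using state by (intro Collect_cong) metis
  also have "\<dots> = op_table False a b (state_table r X)"
    by (auto simp: state_table_def op_table_def)
  finally show ?thesis .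
qed

section \<open>Disjoint union of digraphs\<close>

lemma rtrancl_Un_disjoint:
  assumes "E \<subseteq> V \<times> V" "F \<subseteq> W \<times> W" "V \<inter> W = {}"
  shows "(E \<union> F)\<^sup>* = E\<^sup>* \<union> F\<^sup>*"
proof (intro equalityI subsetI)
  fix p assume "p \<in> (E \<union> F)\<^sup>*"
  then have "(fst p, snd p) \<in> (E \<union> F)\<^sup>*"
    by simp
  then have "(fst p, snd p) \<in> E\<^sup>* \<union> F\<^sup>*"
  proof (induction rule: rtrancl_induct)
    case (step y z)
    have "y = fst p \<or> y \<in> V" if "(fst p, y) \<in> E\<^sup>*"
      using that assms(1) by (auto elim: rtranclE)
    moreover have "y = fst p \<or> y \<in> W" if "(fst p, y) \<in> F\<^sup>*"
      using that assms(2) by (auto elim: rtranclE)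
    \<comment> \<open>A path of length zero lies in both closures and may continue on either side; a
      longer one has already fixed its side.\<close>
    moreover have "(fst p, z) \<in> E\<^sup>* \<union> F\<^sup>*" if "y = fst p"
      using that step by auto
    ultimately show ?case
      using step assms by (blast intro: rtrancl_into_rtrancl)
  qed simp
  then show "p \<in> E\<^sup>* \<union> F\<^sup>*"
    by simp
qed (use rtrancl_mono[of E "E \<union> F"] rtrancl_mono[of F "E \<union> F"] in auto)

lemma rtrancl_subset_Id: "E \<subseteq> V \<times> V \<Longrightarrow> E\<^sup>* \<subseteq> Id \<union> V \<times> V"
proof
  fix p assume E: "E \<subseteq> V \<times> V" and p: "p \<in> E\<^sup>*"
  then have "fst p = snd p \<or> p \<in> E\<^sup>+"
    by (metis prod.collapse rtranclD)
  then show "p \<in> Id \<union> V \<times> V"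
    using trancl_subset_Sigma[OF E] by (cases p) auto
qed

lemma acyclic_Un_disjoint:
  assumes "E \<subseteq> V \<times> V" "F \<subseteq> W \<times> W" "V \<inter> W = {}"
  shows "acyclic (E \<union> F) \<longleftrightarrow> acyclic E \<and> acyclic F"
proof
  assume "acyclic (E \<union> F)"
  then show "acyclic E \<and> acyclic F"
    by (auto intro: acyclic_subset)
next
  assume EF: "acyclic E \<and> acyclic F"
  show "acyclic (E \<union> F)"
    unfolding acyclic_def
  proof (intro allI notI)
    fix x assume "(x, x) \<in> (E \<union> F)\<^sup>+"
    then obtain y where xy: "(x, y) \<in> E \<union> F" and yx: "(y, x) \<in> E\<^sup>* \<union> F\<^sup>*"
      by (metis rtrancl_Un_disjoint[OF assms] tranclD)
    have "(y, x) \<in> E\<^sup>*" if "(x, y) \<in> E"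
      using that yx subsetD[OF rtrancl_subset_Id[OF assms(2)], of "(y, x)"] assms by auto
    moreover have "(y, x) \<in> F\<^sup>*" if "(x, y) \<in> F"
      using that yx subsetD[OF rtrancl_subset_Id[OF assms(1)], of "(y, x)"] assms by auto
    ultimately show False
      using xy EF rtrancl_into_trancl2 unfolding acyclic_def by (metis UnE)
  qed
qed

lemma class_arcs_DUnion:
  "class_arcs (DUnion X Y) S = class_arcs X (S \<inter> dcw_verts X) \<union> class_arcs Y (S \<inter> dcw_verts Y)"
  using dcw_arcs_subset[of X] dcw_arcs_subset[of Y] by (auto simp: class_arcs_def)

lemma class_arcs_subset: "class_arcs X S \<subseteq> dcw_verts X \<times> dcw_verts X"
  using dcw_arcs_subset by (auto simp: class_arcs_def)

lemma acyclic_class_DUnion: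
  assumes "dcw_verts X \<inter> dcw_verts Y = {}"
  shows "acyclic (class_arcs (DUnion X Y) S) \<longleftrightarrow>
    acyclic (class_arcs X (S \<inter> dcw_verts X)) \<and> acyclic (class_arcs Y (S \<inter> dcw_verts Y))"
  unfolding class_arcs_DUnion
  by (rule acyclic_Un_disjoint[OF class_arcs_subset class_arcs_subset assms])

lemma class_rel_DUnion:
  assumes "dcw_verts X \<inter> dcw_verts Y = {}" "S \<subseteq> dcw_verts X \<union> dcw_verts Y"
  shows "class_rel (DUnion X Y) S = class_rel X (S \<inter> dcw_verts X) \<union> class_rel Y (S \<inter> dcw_verts Y)"
    (is "?L = ?RX \<union> ?RY")
proof -
  let ?E = "class_arcs X (S \<inter> dcw_verts X)" and ?F = "class_arcs Y (S \<inter> dcw_verts Y)"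
  have star: "(class_arcs (DUnion X Y) S)\<^sup>* = ?E\<^sup>* \<union> ?F\<^sup>*"
    unfolding class_arcs_DUnion
    by (rule rtrancl_Un_disjoint[OF class_arcs_subset class_arcs_subset assms(1)])
  \<comment> \<open>The summand \<open>Id\<close> stands for paths of length zero. They lie in both
    closures, so a vertex of \<open>X\<close> that is reached in \<open>?F\<^sup>*\<close> from
    itself is also reached in \<open>?E\<^sup>*\<close>.\<close>
  have E: "?E\<^sup>* \<subseteq> Id \<union> dcw_verts X \<times> dcw_verts X" and F: "?F\<^sup>* \<subseteq> Id \<union> dcw_verts Y \<times> dcw_verts Y"
    by (rule rtrancl_subset_Id[OF class_arcs_subset])+
  show ?thesis
  proof (intro equalityI subsetI)
    fix p assume "p \<in> ?L"
    then obtain u v where p: "p = (dcw_label (DUnion X Y) u, dcw_label (DUnion X Y) v)"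
      "u \<in> S" "v \<in> S" "(u, v) \<in> ?E\<^sup>* \<union> ?F\<^sup>*"
      unfolding class_rel_def star by blast
    consider "u \<in> dcw_verts X" | "u \<in> dcw_verts Y" "u \<notin> dcw_verts X"
      using p(2) assms(2) by blast
    then show "p \<in> ?RX \<union> ?RY"
    proof cases
      case 1
      then have "(u, v) \<in> ?E\<^sup>*" "v \<in> dcw_verts X"
        using p(4) E F assms(1) by auto
      with 1 p show ?thesis
        by (auto simp: class_rel_def)
    next
      case 2
      then have "(u, v) \<in> ?F\<^sup>*" "v \<in> dcw_verts Y" "v \<notin> dcw_verts X"
        using p(4) E F assms(1) by auto
      with 2 p show ?thesis
        by (auto simp: class_rel_def)
    qed
  next
    fix p assume "p \<in> ?RX \<union> ?RY"
    then consider u v where "p = (dcw_label X u, dcw_label X v)" "u \<in> S" "v \<in> S"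
        "u \<in> dcw_verts X" "v \<in> dcw_verts X" "(u, v) \<in> ?E\<^sup>*"
      | u v where "p = (dcw_label Y u, dcw_label Y v)" "u \<in> S" "v \<in> S"
        "u \<in> dcw_verts Y" "v \<in> dcw_verts Y" "(u, v) \<in> ?F\<^sup>*"
      by (auto simp: class_rel_def)
    then show "p \<in> ?L"
    proof cases
      case 1
      then have "p = (dcw_label (DUnion X Y) u, dcw_label (DUnion X Y) v)" by simp
      with 1 show ?thesis
        unfolding class_rel_def star by blast
    next
      case 2
      then have "u \<notin> dcw_verts X" "v \<notin> dcw_verts X"
        using assms(1) by auto
      then have "p = (dcw_label (DUnion X Y) u, dcw_label (DUnion X Y) v)"
        using 2 by simp
      with 2 show ?thesis
        unfolding class_rel_def star by blast
    qed
  qed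
qed

text \<open>Restricting a colouring to the two sides gives one inclusion. For the other, the two
  colourings were made independently and \<open>Z\<close> pairs their classes arbitrarily, so the
  colours on \<open>Y\<close> are permuted until paired classes have the same colour.\<close>

lemma state_table_DUnion:
  assumes "dcw_verts X \<inter> dcw_verts Y = {}"
  shows "state_table r (DUnion X Y) = merge_tables (state_table r X) (state_table r Y)"
proof (intro equalityI subsetI)
  let ?X = "\<lambda>c i. class_rel X (color_class X c i)" and ?Y = "\<lambda>c i. class_rel Y (color_class Y c i)"
  have cls: "color_class (DUnion X Y) c i \<inter> dcw_verts X = color_class X c i"
    "color_class (DUnion X Y) c i \<inter> dcw_verts Y = color_class Y c i" for c i
    by (auto simp: color_class_def)
  have rel: "class_rel (DUnion X Y) (color_class (DUnion X Y) c i) = ?X c i \<union> ?Y c i" for c i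
    using class_rel_DUnion[OF assms, of "color_class (DUnion X Y) c i"] color_class_subset[of
      "DUnion X Y" c i]
    by (simp add: cls)
  have col: "acyclic_coloring r (DUnion X Y) c \<longleftrightarrow> acyclic_coloring r X c \<and> acyclic_coloring r Y c"
    for c
    using acyclic_class_DUnion[OF assms] by (auto simp: acyclic_coloring_def cls)
  {
    fix M assume "M \<in> state_table r (DUnion X Y)"
    then obtain c where c: "M = coloring_state r (DUnion X Y) c" "acyclic_coloring r (DUnion X Y) c"
      by (auto simp: state_table_def)
    let ?Z = "image_mset (\<lambda>i. (?X c i, ?Y c i)) (mset_set {..<r})"
    have "M = image_mset (\<lambda>(x, y). x \<union> y) ?Z"
      by (simp add: c(1) coloring_state_def rel multiset.map_comp o_def)
    moreover have "image_mset fst ?Z = coloring_state r X c"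
      "image_mset snd ?Z = coloring_state r Y c"
      by (simp_all add: coloring_state_def multiset.map_comp o_def)
    ultimately show "M \<in> merge_tables (state_table r X) (state_table r Y)"
      using c(2) col unfolding merge_tables_def state_table_def by blast
  }
  fix M assume "M \<in> merge_tables (state_table r X) (state_table r Y)"
  then obtain Z c d where Z: "M = image_mset (\<lambda>(x, y). x \<union> y) Z"
    "image_mset fst Z = coloring_state r X c" "image_mset snd Z = coloring_state r Y d"
    "acyclic_coloring r X c" "acyclic_coloring r Y d"
    by (auto simp: merge_tables_def state_table_def)
  \<comment> \<open>Passing to lists makes positions available: \<open>Z\<close> is enumerated so
    that its entry at position \<open>i\<close> belongs to colour \<open>i\<close> of
    \<open>c\<close>.\<close>
  have upt: "mset_set {..<r} = mset [0..<r]"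
    by (simp add: lessThan_atLeast0)
  have "mset (map (?X c) [0..<r]) = image_mset fst Z"
    unfolding Z(2) coloring_state_def upt mset_map ..
  then obtain zs where zs: "map (?X c) [0..<r] = map fst zs" "mset zs = Z"
    using mset_eq_image_mset by metis
  have len: "length zs = r"
    using arg_cong[OF zs(1), of length] by simp
  have "mset (map snd zs) = mset (map (?Y d) [0..<r])"
    unfolding mset_map zs(2) Z(3) coloring_state_def upt ..
  then obtain p where p: "p permutes {..<length (map (?Y d) [0..<r])}"
    "permute_list p (map (?Y d) [0..<r]) = map snd zs"
    by (rule mset_eq_permutation)
  have perm: "p permutes {..<r}"
    using p(1) by simp
  have zs_nth: "zs ! i = (?X c i, ?Y d (p i))" if "i < r" for i
  proof -
    have "fst (zs ! i) = ?X c i"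
      using arg_cong[OF zs(1), of "\<lambda>l. l ! i"] that len by simp
    moreover have "snd (zs ! i) = ?Y d (p i)"
      using arg_cong[OF p(2), of "\<lambda>l. l ! i"] that len permutes_in_image[OF perm, of i]
      by (simp add: permute_list_def)
    ultimately show ?thesis
      by (simp add: prod_eq_iff)
  qed
  \<comment> \<open>Colour \<open>i\<close> of \<open>c\<close> is paired with colour
    \<open>p i\<close> of \<open>d\<close>; hence a vertex of \<open>Y\<close> with colour
    \<open>j\<close> under \<open>d\<close> receives the colour \<open>inv p j\<close>.\<close>
  define e where "e v = (if v \<in> dcw_verts X then c v else inv p (d v))" for v
  have eX: "color_class X e i = color_class X c i" for i
    by (auto simp: color_class_def e_def)
  have eY: "color_class Y e i = color_class Y d (p i)" for i
  proof -
    have "inv p j = i \<longleftrightarrow> j = p i" for j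
      using permutes_inverses[OF perm] by metis
    with assms show ?thesis
      by (auto simp: color_class_def e_def)
  qed
  have "acyclic_coloring r X e"
    using Z(4) by (simp add: acyclic_coloring_def eX) (simp add: e_def)
  moreover have "acyclic_coloring r Y e"
    unfolding acyclic_coloring_def eY
  proof (intro conjI ballI allI impI)
    fix v assume "v \<in> dcw_verts Y"
    then show "e v < r"
      using Z(5) assms permutes_in_image[OF permutes_inv[OF perm], of "d v"]
      by (auto simp: acyclic_coloring_def e_def)
  next
    fix i assume "i < r"
    then show "acyclic (class_arcs Y (color_class Y d (p i)))"
      using Z(5) permutes_in_image[OF perm, of i] by (auto simp: acyclic_coloring_def)
  qed
  moreover have "M = coloring_state r (DUnion X Y) e"
  proof -
    have "zs = map (\<lambda>i. (?X c i, ?Y d (p i))) [0..<r]"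
      by (rule nth_equalityI) (simp_all add: len zs_nth)
    then have "M = image_mset (\<lambda>(x, y). x \<union> y) (mset (map (\<lambda>i. (?X c i, ?Y d (p i))) [0..<r]))"
      using Z(1) zs(2) by simp
    also have "\<dots> = coloring_state r (DUnion X Y) e"
      unfolding coloring_state_def upt rel eX eY by (simp add: multiset.map_comp o_def)
    finally show ?thesis .
  qed
  ultimately show "M \<in> state_table r (DUnion X Y)"
    using col unfolding state_table_def by blast
qed

section \<open>From acyclic colourings to partitions into acyclic sets\<close>

lemma acyclic_digraph_induced_iff:
  assumes "S \<subseteq> dcw_verts X"
  shows "acyclic_digraph (with_proj (dcw_digraph X) \<restriction> S) \<longleftrightarrow> acyclic (class_arcs X S)"
proof -
  let ?H = "with_proj (dcw_digraph X) \<restriction> S"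
  interpret wf_digraph ?H
    by unfold_locales auto
  have ends: "arcs_ends ?H = class_arcs X S"
    by (force simp: arcs_ends_def arc_to_ends_def class_arcs_def dcw_digraph_def)
  have "(\<exists>p. cycle p) \<longleftrightarrow> (\<exists>u. (u, u) \<in> (class_arcs X S)\<^sup>+)"
  proof
    assume "\<exists>p. cycle p"
    then show "\<exists>u. (u, u) \<in> (class_arcs X S)\<^sup>+"
      unfolding cycle_def using reachable1_awalkI ends by metis
  next
    assume "\<exists>u. (u, u) \<in> (class_arcs X S)\<^sup>+"
    then obtain u p where "awalk u p u" "p \<noteq> []"
      using reachable1_awalk ends by metis
    \<comment> \<open>A walk obtained from the transitive closure may repeat vertices;
      \<open>closed_w_imp_cycle\<close> extracts a proper cycle from it.\<close>
    then have "closed_w p"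
      by (auto simp: closed_w_def)
    then show "\<exists>p. cycle p"
      by (rule closed_w_imp_cycle)
  qed
  then show ?thesis
    by (auto simp: acyclic_digraph_def acyclic_def)
qed

lemma acyclic_class_mono: "acyclic (class_arcs X S) \<Longrightarrow> S' \<subseteq> S \<Longrightarrow> acyclic (class_arcs X S')"
  by (rule acyclic_subset) (auto simp: class_arcs_def)

text \<open>With fewer parts than elements some part has at least two elements, and a single element
  can be cut off from it.\<close>

lemma partition_on_split:
  assumes "finite A" "partition_on A P" "card P < card A"
  obtains S T U where "S \<in> P" "T \<subseteq> S" "U \<subseteq> S" "partition_on A (insert T (insert U (P - {S})))"
    "card (insert T (insert U (P - {S}))) = Suc (card P)"
proof -
  have P: "\<Union>P = A" "disjoint P" "{} \<notin> P" "finite P"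
    using assms(2) finite_elements[OF assms(1,2)] by (auto simp: partition_on_def)
  have "\<exists>S\<in>P. 2 \<le> card S"
  proof (rule ccontr)
    assume "\<not> (\<exists>S\<in>P. 2 \<le> card S)"
    then have "card S \<le> 1" if "S \<in> P" for S
      using that by fastforce
    then have "card (\<Union>P) \<le> (\<Sum>S\<in>P. 1)"
      using card_Union_le_sum_card[of P] sum_mono[of P card "\<lambda>_. 1"] by (meson order_trans)
    with assms(3) P(1) show False
      by simp
  qed
  then obtain S where S: "S \<in> P" "2 \<le> card S"
    by blast
  then obtain x where x: "x \<in> S"
    by fastforce
  let ?U = "S - {x}"
  have U: "?U \<noteq> {}"
    using S(2) x card_mono[of "{x}" S] by fastforce
  have notin: "T \<notin> P - {S}" if "T \<subseteq> S" "T \<noteq> {}" for T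
    using that S(1) P(2) unfolding disjoint_def by blast
  have disj: "T \<inter> S = {}" if "T \<in> P - {S}" for T
    using that S(1) P(2) unfolding disjoint_def by blast
  let ?P = "insert {x} (insert ?U (P - {S}))"
  have "partition_on A ?P"
    unfolding partition_on_def
  proof (intro conjI)
    show "\<Union>?P = A"
      using P(1) S(1) x by blast
    show "disjoint ?P"
      using P(2) disj x unfolding disjoint_def by auto
    show "{} \<notin> ?P"
      using P(3) U by auto
  qed
  moreover have "card ?P = Suc (card P)"
  proof -
    have "?U \<notin> P - {S}"
      by (rule notin) (use U in auto)
    moreover have "{x} \<notin> insert ?U (P - {S})"
      using notin[of "{x}"] x by auto
    ultimately have "card ?P = Suc (Suc (card (P - {S})))"
      using P(4) by simp
    then show ?thesis
      using card_Suc_Diff1[OF P(4) S(1)] by simp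
  qed
  ultimately show ?thesis
    using that[of S "{x}" ?U] S(1) x by auto
qed

text \<open>Parts are split one at a time until exactly \<open>r\<close> are reached; a hereditary
  property such as acyclicity survives because parts only shrink.\<close>

lemma partition_on_refine:
  assumes "finite A" "partition_on A P" "card P \<le> r" "r \<le> card A" "\<forall>S\<in>P. Q S"
    and hereditary: "\<And>S T. Q S \<Longrightarrow> T \<subseteq> S \<Longrightarrow> Q T"
  shows "\<exists>P'. partition_on A P' \<and> card P' = r \<and> (\<forall>S\<in>P'. Q S)"
  using assms(3,4)
proof (induction r rule: dec_induct)
  case base
  show ?case
    using assms by blast
next
  case (step n)
  then obtain P' where P': "partition_on A P'" "card P' = n" "\<forall>S\<in>P'. Q S"
    by auto
  then obtain S T U where "S \<in> P'" "T \<subseteq> S" "U \<subseteq> S" "partition_on A (insert T (insert U (P' - {S})))"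
    "card (insert T (insert U (P' - {S}))) = Suc (card P')"
    using partition_on_split[OF assms(1), of P'] step.prems by (metis Suc_le_lessD)
  moreover have "\<forall>S\<in>insert T (insert U (P' - {S})). Q S"
    using P'(3) \<open>S \<in> P'\<close> \<open>T \<subseteq> S\<close> \<open>U \<subseteq> S\<close> hereditary by blast
  ultimately show ?case
    using P'(2) by blast
qed

lemma acyclic_partitionable_iff:
  assumes "r \<le> card (dcw_verts X)"
  shows "acyclic_partitionable (dcw_digraph X) r \<longleftrightarrow> state_table r X \<noteq> {}"
proof -
  let ?V = "dcw_verts X"
  have "acyclic_partitionable (dcw_digraph X) r \<longleftrightarrow>
      (\<exists>P. partition_on ?V P \<and> card P = r \<and> (\<forall>S\<in>P. acyclic (class_arcs X S)))"
  proof -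
    have "S \<subseteq> ?V" if "partition_on ?V P" "S \<in> P" for P S
      using that by (auto simp: partition_on_def)
    then show ?thesis
      unfolding acyclic_partitionable_def dcw_digraph_def[of X, THEN arg_cong, of pverts,
        simplified]
      using acyclic_digraph_induced_iff[of _ X] by metis
  qed
  also have "\<dots> \<longleftrightarrow> (\<exists>c. acyclic_coloring r X c)"
  proof
    assume "\<exists>P. partition_on ?V P \<and> card P = r \<and> (\<forall>S\<in>P. acyclic (class_arcs X S))"
    then obtain P where P: "partition_on ?V P" "card P = r" "\<forall>S\<in>P. acyclic (class_arcs X S)"
      by blast
    then obtain h where h: "bij_betw h P {..<r}"
      using finite_elements[OF finite_dcw_verts P(1)] finite_same_card_bij[of P "{..<r}"] by auto
    define c where "c v = h (THE S. S \<in> P \<and> v \<in> S)" for v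
    have c: "c v = h S" if "S \<in> P" "v \<in> S" for v S
    proof -
      have "(THE S. S \<in> P \<and> v \<in> S) = S"
        using that partition_onD2[OF P(1)] by (intro the_equality) (auto simp: disjoint_def)
      then show ?thesis
        by (simp add: c_def)
    qed
    have bound: "c v < r" if v: "v \<in> ?V" for v
    proof -
      obtain S where "S \<in> P" "v \<in> S"
        using v partition_onD1[OF P(1)] by auto
      then show ?thesis
        using c h by (auto simp: bij_betw_def)
    qed
    moreover have "acyclic (class_arcs X (color_class X c i))" if "i < r" for i
    proof -
      have "i \<in> h ` P"
        using \<open>i < r\<close> h by (simp add: bij_betw_def)
      then obtain S where S: "S \<in> P" "h S = i"
        by blast
      have "color_class X c i \<subseteq> S"
      proof
        fix v assume "v \<in> color_class X c i"
        then obtain T where T: "T \<in> P" "v \<in> T" "c v = i"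
          using partition_onD1[OF P(1)] by (auto simp: color_class_def)
        then have "h T = h S"
          using c S(2) by simp
        then show "v \<in> S"
          using h S(1) T(1,2) by (auto simp: bij_betw_def inj_on_def)
      qed
      then show ?thesis
        using acyclic_class_mono P(3) S(1) by blast
    qed
    ultimately show "\<exists>c. acyclic_coloring r X c"
      unfolding acyclic_coloring_def by blast
  next
    assume "\<exists>c. acyclic_coloring r X c"
    then obtain c where c: "acyclic_coloring r X c"
      by blast
    \<comment> \<open>Dropping empty classes may leave fewer than \<open>r\<close> parts;
      \<open>partition_on_refine\<close> restores the number, which is where
      \<open>r \<le> card (dcw_verts X)\<close> enters.\<close>
    let ?P = "color_class X c ` {..<r} - {{}}"
    have "partition_on ?V ?P"
      unfolding partition_on_def
    proof (intro conjI)
      show "\<Union>?P = ?V"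
        using c by (auto simp: acyclic_coloring_def color_class_def)
      show "disjoint ?P"
        by (auto simp: disjoint_def color_class_def)
    qed simp
    moreover have "card ?P \<le> r"
    proof -
      have "card ?P \<le> card (color_class X c ` {..<r})"
        by (intro card_mono) auto
      also have "\<dots> \<le> card {..<r}"
        by (rule card_image_le) simp
      finally show ?thesis
        by simp
    qed
    moreover have "\<forall>S\<in>?P. acyclic (class_arcs X S)"
      using c by (auto simp: acyclic_coloring_def)
    ultimately show "\<exists>P. partition_on ?V P \<and> card P = r \<and> (\<forall>S\<in>P. acyclic (class_arcs X S))"
      using assms acyclic_class_mono by (intro partition_on_refine) auto
  qed
  also have "\<dots> \<longleftrightarrow> state_table r X \<noteq> {}"
    by (auto simp: state_table_def)
  finally show ?thesis .
qed

lemma has_union_iff: "dcw_k_exp k X \<Longrightarrow> has_union X \<longleftrightarrow> 2 \<le> card (dcw_verts X)"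
proof (induction X)
  case (DUnion X Y)
  have "1 \<le> card (dcw_verts Z)" for Z
  proof -
    have "dcw_verts Z \<noteq> {}"
      by (induction Z) auto
    then show ?thesis
      by (simp add: Suc_leI card_gt_0_iff)
  qed
  from this[of X] this[of Y] DUnion.prems show ?case
    by (simp add: card_Un_disjoint)
qed auto

text \<open>This justifies the immediate positive answer of \<open>main_body\<close> when there is
  no disjoint union.\<close>

lemma state_table_no_union:
  "\<not> has_union X \<Longrightarrow> dcw_k_exp k X \<Longrightarrow> 1 \<le> r \<Longrightarrow> state_table r X \<noteq> {}"
proof (induction X)
  case (Vertex a v)
  then show ?case
    by (simp add: state_table_Vertex)
next
  case (AddArcs a b X)
  have single: "card (dcw_verts X) \<le> 1"
    using AddArcs.prems has_union_iff[of k X] by simp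
  obtain M where M: "M \<in> state_table r X"
    using AddArcs by auto
  \<comment> \<open>The only vertex cannot carry both labels, since an expression requires
    \<open>a \<noteq> b\<close> when inserting arcs.\<close>
  have "(b, a) \<notin> R" if "R \<in># M" for R
  proof
    assume "(b, a) \<in> R"
    with that M obtain u v where "u \<in> dcw_verts X" "v \<in> dcw_verts X" "dcw_label X u = b"
      "dcw_label X v = a"
      by (auto simp: state_table_def coloring_state_def class_rel_def color_class_def)
    with AddArcs.prems(2) single show False
      by (auto simp: card_le_Suc0_iff_eq)
  qed
  with M show ?case
    by (auto simp: state_table_AddArcs op_table_def)
next
  case (Relabel a b X)
  then show ?case
    by (auto simp: state_table_Relabel op_table_def)
qed simp

section \<open>The dichromatic number\<close>

context universe
begin

text \<open>The product of two tables, at \<open>B ^ 14\<close>, is the most expensive operation. A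
  further factor \<open>B\<close> pays for the constants, and the costs add up over the nodes of the
  expression.\<close>

lemma table_runs:
  assumes "1 \<le> r" "dcw_k_exp k X"
  shows "does table_fn [enc_exp X, enc_nat r] (set_tree (enc_state ` state_table r X))
    (dcw_size X * B ^ 15)"
  using assms(2)
proof (induction X)
  case (Vertex a v)
  obtain n where n: "r = Suc n"
    using assms(1) by (cases r) auto
  have a: "{(a, a)} \<in> rels k"
    using Vertex by (simp add: rels_def)
  have enc: "enc_state {#{(a, a)}#} = Cell (Cell (Cell (enc_nat a) (enc_nat a)) Leaf) Leaf"
    by (simp add: enc_state_def mset_tree_def enc_rel_def set_tree_def enc_pair_def)
  have "does pad_fn [Cell (Cell (Cell (enc_nat a) (enc_nat a)) Leaf) Leaf, enc_nat n]
      (enc_state (add_mset {(a, a)} (replicate_mset n {}))) (B ^ 6)"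
    using runs_loop[OF pad_runs[OF a, of n]] n r by (simp add: enc)
  then show ?case
    using pow_Suc_ge[of 14] pow_mono[of 6 14] pow_large[of 14] assms(1) state_table_Vertex[of r a v]
    by (intro runsI) (simp_all add: body_defs ok_simps runs_def n set_tree_def)
next
  case (DUnion X Y)
  then have "does product_fn [set_tree (enc_state ` state_table r X),
    set_tree (enc_state ` state_table r Y)]
      (set_tree (enc_state ` state_table r (DUnion X Y))) (B ^ 14)"
    using product_runs[OF state_table_subset state_table_subset] by (simp add: state_table_DUnion)
  with DUnion show ?case
    using pow_Suc_ge[of 14] pow_large[of 14]
    by (intro runsI) (simp_all add: body_defs ok_simps runs_def algebra_simps)
next
  case (AddArcs a b X)
  then have "does op_table_fn [Leaf, enc_nat a, enc_nat b, set_tree (enc_state ` state_table r X)]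
      (set_tree (enc_state ` state_table r (AddArcs a b X))) (B ^ 13)"
    using op_table_runs[OF state_table_subset,
      of X a b False] by (simp add: state_table_AddArcs enc_bool_def)
  with AddArcs show ?case
    using pow_Suc_ge[of 14] pow_mono[of 13 14] pow_large[of 14]
    by (intro runsI) (simp_all add: body_defs ok_simps runs_def algebra_simps)
next
  case (Relabel a b X)
  then have "does op_table_fn [Cell Leaf Leaf, enc_nat a, enc_nat b,
    set_tree (enc_state ` state_table r X)]
      (set_tree (enc_state ` state_table r (Relabel a b X))) (B ^ 13)"
    using op_table_runs[OF state_table_subset,
      of X a b True] by (simp add: state_table_Relabel enc_bool_def)
  with Relabel show ?case
    using pow_Suc_ge[of 14] pow_mono[of 13 14] pow_large[of 14]
    by (intro runsI) (simp_all add: body_defs ok_simps runs_def algebra_simps)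
qed

lemma main_runs:
  assumes "1 \<le> r" "dcw_k_exp k X" "has_union X"
  shows "does main_fn [Cell (enc_exp X) (enc_nat r)] (enc_bool (state_table r X \<noteq> {}))
    (dcw_size X * B ^ 15 + 20 * dcw_size X + 20)"
proof -
  have "finite (state_table r X)"
    using states_subset_bounds(1)[OF state_table_subset[OF assms(2)]] .
  then have "set_tree (enc_state ` state_table r X) = Leaf \<longleftrightarrow> state_table r X = {}"
    using set_tree_eq_iff[of "enc_state ` state_table r X" "{}"] by simp
  then show ?thesis
    using has_union_runs[of X] table_runs[OF assms(1,2)] assms(3)
    by (intro runsI) (simp_all add: body_defs ok_simps runs_def enc_bool_def)
qed

end

lemma main_runs_no_union:
  assumes "\<not> has_union X"
  shows "does main_fn [Cell (enc_exp X) (enc_nat r)] (enc_bool True) (20 * dcw_size X + 20)"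
  using has_union_runs[of X] assms
  by (intro runsI) (simp_all add: body_defs ok_simps runs_def enc_bool_def)

text \<open>The two extra steps are the evaluation of \<open>TVar 0\<close> and the initial
  call.\<close>

lemma runs_imp_outputs_within:
  assumes "does main_fn [x] y T"
  shows "outputs_within dichrom x y (T + 2)"
proof -
  obtain t where t: "t \<le> T" "eval dichrom [x] (dichrom ! main_fn) y t"
    using runs_imp_eval[OF assms] by blast
  have "eval dichrom [x] (TVar 0) ([x] ! 0) 1"
    by (rule eval_Var) simp
  then have "evals dichrom [x] [TVar 0] [x] (1 + 0)"
    by (intro evals_Cons evals_Nil) simp
  then have "eval dichrom [x] (TCall main_fn [TVar 0]) y (1 + 0 + t + 1)"
    using t(2) by (intro eval_Call) simp_all
  with t(1) show ?thesis
    unfolding outputs_within_def by (intro exI[of _ "1 + 0 + t + 1"]) simp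
qed

section \<open>Size bounds for encodings and the choice of \<open>B\<close>\<close>

lemma nodes_enc_nat: "nodes (enc_nat a) = 2 * a + 1"
  by (induction a) auto

lemma nodes_enc_rel:
  assumes "R \<in> rels k"
  shows "nodes (enc_rel R) \<le> 1 + k\<^sup>2 * (4 * k + 4)"
proof -
  let ?xs = "sorted_list_of_set (enc_pair ` R)"
  have fin: "finite R" "R \<subseteq> {1..k} \<times> {1..k}"
    using assms finite_rels by (auto simp: rels_def)
  \<comment> \<open>Two labels of at most \<open>2 * k + 1\<close> nodes, the cell that joins them,
    and the cell of the list.\<close>
  have elem: "nodes x + 1 \<le> 4 * k + 4" if "x \<in> set ?xs" for x
    using that fin by (auto simp: enc_pair_def nodes_enc_nat)
  have "(\<Sum>x\<leftarrow>?xs. nodes x + 1) \<le> (\<Sum>x\<leftarrow>?xs. 4 * k + 4)"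
    by (rule sum_list_mono) (use elem in blast)
  also have "\<dots> = card R * (4 * k + 4)"
    using fin by (simp add: sum_list_triv card_image inj_enc_pair)
  also have "\<dots> \<le> k\<^sup>2 * (4 * k + 4)"
    using card_mono[OF _ fin(2)] by (intro mult_le_mono) (auto simp: power2_eq_square)
  finally show ?thesis
    by (simp add: enc_rel_def set_tree_def nodes_lst)
qed

lemma nodes_enc_state:
  assumes "set_mset M \<subseteq> rels k"
  shows "nodes (enc_state M) \<le> 1 + size M * (2 + k\<^sup>2 * (4 * k + 4))"
proof -
  let ?xs = "sorted_list_of_multiset (image_mset enc_rel M)"
  have elem: "nodes x + 1 \<le> 2 + k\<^sup>2 * (4 * k + 4)" if "x \<in> set ?xs" for x
    using that assms nodes_enc_rel by fastforce
  have "(\<Sum>x\<leftarrow>?xs. nodes x + 1) \<le> (\<Sum>x\<leftarrow>?xs. 2 + k\<^sup>2 * (4 * k + 4))"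
    by (rule sum_list_mono) (use elem in blast)
  also have "\<dots> = size M * (2 + k\<^sup>2 * (4 * k + 4))"
    by (simp add: sum_list_triv)
  finally show ?thesis
    by (simp add: enc_state_def mset_tree_def nodes_lst)
qed

text \<open>Since \<open>n\<close> is at least 2, constants and \<open>k\<close> can be turned into
  powers of \<open>n\<close>, for instance via \<open>k \<le> 2 ^ k\<close>. The number of merges
  needs the exponent \<open>2 ^ (k\<^sup>2 + 3)\<close>; as \<open>k\<close> is positive,
  \<open>4 * k\<^sup>2\<close> dominates \<open>k\<^sup>2 + 3\<close>, the \<open>3 + k\<close>
  needed for encoding sizes, and the 4 needed for the threshold 1000.\<close>

lemma universe_bound:
  assumes "2 \<le> n" "1 \<le> k" "r \<le> n"
  shows "universe (n ^ 2 ^ (4 * k\<^sup>2)) k r"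
proof -
  let ?B = "n ^ 2 ^ (4 * k\<^sup>2)"
  have k2: "k \<le> k\<^sup>2" "1 \<le> k\<^sup>2"
    using assms(2) by (simp_all add: power2_eq_square)
  have B: "n ^ e \<le> ?B" if "e \<le> 2 ^ j" "j \<le> 4 * k\<^sup>2" for e j
  proof -
    have "e \<le> 2 ^ (4 * k\<^sup>2)"
      by (rule order_trans[OF that(1)]) (use that(2) in simp)
    then show ?thesis
      using assms(1) by (intro power_increasing) auto
  qed
  have "(1000 :: nat) \<le> 2 ^ 10"
    by simp
  also have "\<dots> \<le> n ^ 10"
    using assms(1) by (rule power_mono) simp
  also have "\<dots> \<le> ?B"
    using k2 by (intro B[of _ 4]) auto
  finally have large: "1000 \<le> ?B" .
  have "r + 1 \<le> n ^ 2"
  proof -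
    have "n + 1 \<le> 2 * n" "2 * n \<le> n * n"
      using assms(1) by auto
    then have "r + 1 \<le> n * n"
      using assms(3) by linarith
    then show ?thesis
      by (simp only: power2_eq_square)
  qed
  then have "(r + 1) ^ (2 * 2 ^ k\<^sup>2) \<le> (n ^ 2) ^ (2 * 2 ^ k\<^sup>2)"
    by (rule power_mono) simp
  also have "\<dots> = n ^ (2 * (2 * 2 ^ k\<^sup>2))"
    by (simp only: power_mult)
  also have "\<dots> < n ^ (2 * (2 * 2 ^ k\<^sup>2) + 1)"
    using assms(1) by (intro power_strict_increasing) auto
  also have "\<dots> \<le> ?B"
    using k2 by (intro B[of _ "k\<^sup>2 + 3"]) (auto simp: power_add)
  finally have card: "card (merges k r) < ?B"
    using finite_card_merges(2)[of k r] by (rule le_less_trans[rotated])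
  \<comment> \<open>A bound for an encoded merge: the 3 counts its root cell and the ends of its two
    lists, and the second factor allows for one relation together with its list cell.\<close>
  have "3 + n * (2 + k\<^sup>2 * (4 * k + 4)) \<le> 16 * (n * k ^ 3)"
  proof -
    have "k\<^sup>2 * (4 * k + 4) = 4 * k ^ 3 + 4 * k\<^sup>2"
      by (simp add: algebra_simps power2_eq_square power3_eq_cube)
    moreover have "k\<^sup>2 \<le> k ^ 3" "1 \<le> k ^ 3"
      using assms(2) power_increasing[of 2 3 k] by simp_all
    ultimately have "2 + k\<^sup>2 * (4 * k + 4) \<le> 10 * k ^ 3"
      by linarith
    then have "n * (2 + k\<^sup>2 * (4 * k + 4)) \<le> n * (10 * k ^ 3)"
      by (rule mult_le_mono2)
    moreover have "n * 1 \<le> n * k ^ 3"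
      using \<open>1 \<le> k ^ 3\<close> by (rule mult_le_mono2)
    ultimately show ?thesis
      using assms(1) by linarith
  qed
  also have "\<dots> \<le> n ^ 4 * (n * (n ^ k) ^ 3)"
  proof (intro mult_le_mono power_mono order_refl)
    show "16 \<le> n ^ 4"
      using power_mono[of 2 n 4] assms(1) by simp
    have "k \<le> 2 ^ k"
      by (simp add: less_imp_le)
    also have "\<dots> \<le> n ^ k"
      using assms(1) by (rule power_mono) simp
    finally show "k \<le> n ^ k" .
  qed simp
  also have "\<dots> = n ^ (5 + k * 3)"
    by (simp add: power_add power_mult numeral_eq_Suc)
  also have "\<dots> \<le> ?B"
  proof (rule B)
    have "5 + k * 3 \<le> 8 * k"
      using assms(2) by simp
    also have "\<dots> \<le> 2 ^ (3 + k)"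
      by (simp add: power_add less_imp_le)
    finally show "5 + k * 3 \<le> 2 ^ (3 + k)" .
    show "3 + k \<le> 4 * k\<^sup>2"
      using k2 by simp
  qed
  finally have main: "3 + n * (2 + k\<^sup>2 * (4 * k + 4)) \<le> ?B" .
  show ?thesis
  proof
    show "1000 \<le> ?B" "card (merges k r) < ?B"
      by fact+
    define D where "D = 2 + k\<^sup>2 * (4 * k + 4)"
    have D: "3 + n * D \<le> ?B" "D \<le> n * D" "n \<le> n * D"
    proof -
      show "3 + n * D \<le> ?B" "n \<le> n * D"
        using main by (simp_all add: D_def)
      show "D \<le> n * D"
        using assms(1) by simp
    qed
    show "nodes (enc_rel R) \<le> ?B" if "R \<in> rels k" for R
    proof -
      have "nodes (enc_rel R) \<le> D"
        using nodes_enc_rel[OF that] by (simp add: D_def)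
      with D show ?thesis
        by linarith
    qed
    show "r < ?B"
      using D assms(3) by linarith
    fix p assume "p \<in> merges k r"
    then obtain M N where p: "p = (M, N)" "set_mset M \<subseteq> rels k" "set_mset N \<subseteq> rels k"
      "size M + size N = r"
      by (auto simp: merges_def)
    have "nodes (enc_merge p) \<le> 3 + (size M + size N) * D"
      using nodes_enc_state[OF p(2)] nodes_enc_state[OF p(3)]
      unfolding p(1) enc_merge_def add_mult_distrib D_def by simp
    also have "\<dots> \<le> 3 + n * D"
      using p(4) assms(3) by (intro add_left_mono mult_le_mono1) simp
    finally show "nodes (enc_merge p) \<le> ?B"
      using D(1) by linarith
  qed
qed

lemma one_le_dcw_size: "1 \<le> dcw_size X"
  by (induction X) auto

lemma dcw_k_exp_pos: "dcw_k_exp k X \<Longrightarrow> 1 \<le> k"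
  by (induction X) auto

lemma mult_le_sum_squares: "x * y \<le> x\<^sup>2 + y\<^sup>2" for x y :: nat
  by (cases "x \<le> y") (simp_all add: power2_eq_square trans_le_add1 trans_le_add2)

text \<open>The total is at most \<open>dcw_size X * B ^ 16\<close>, and squaring
  \<open>B ^ 16\<close> gives \<open>B ^ 32\<close>, whence the \<open>+ 5\<close> in the exponent.
  The constant 50 only has to exceed the 42 that arises without a disjoint union; it also serves as
  exponent because the theorem uses one \<open>c\<close> in both places.\<close>

lemma dichrom_solves:
  assumes "dcw_k_exp k X" "n = card (pverts (dcw_digraph X))" "1 \<le> r" "r \<le> n"
  shows "solves_dichromatic_within dichrom X r (50 * dcw_size X ^ 50 + n ^ 2 ^ (4 * k\<^sup>2 + 5))"
proof -
  let ?s = "dcw_size X"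
  have n: "n = card (dcw_verts X)"
    using assms(2) by (simp add: dcw_digraph_def)
  have part: "acyclic_partitionable (dcw_digraph X) r \<longleftrightarrow> state_table r X \<noteq> {}"
    using acyclic_partitionable_iff assms(4) n by simp
  have s: "1 \<le> ?s" "?s \<le> ?s ^ 50" "?s ^ 2 \<le> ?s ^ 50"
    using one_le_dcw_size[of X] power_increasing[of 1 50 ?s] power_increasing[of 2 50 ?s]
      by simp_all
  obtain T where T: "outputs_within dichrom (Cell (enc_exp X) (enc_nat r))
    (enc_bool (state_table r X \<noteq> {})) T"
    "T \<le> 50 * ?s ^ 50 + n ^ 2 ^ (4 * k\<^sup>2 + 5)"
  proof (cases "has_union X")
    case False
    have "outputs_within dichrom (Cell (enc_exp X) (enc_nat r)) (enc_bool (state_table r X \<noteq> {}))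
      (20 * ?s + 20 + 2)"
      using runs_imp_outputs_within[OF main_runs_no_union[OF False]]
        state_table_no_union[OF False assms(1,3)]
      by simp
    moreover have "20 * ?s + 20 + 2 \<le> 50 * ?s ^ 50 + n ^ 2 ^ (4 * k\<^sup>2 + 5)"
      using s by linarith
    ultimately show ?thesis
      by (rule that)
  next
    case True
    let ?B = "n ^ 2 ^ (4 * k\<^sup>2)"
    interpret universe ?B k r
      using True has_union_iff[OF assms(1)] dcw_k_exp_pos[OF assms(1)] assms(4) n
        by (intro universe_bound) auto
    have "?s * ?B ^ 15 + 20 * ?s + 20 + 2 \<le> ?s * ?B ^ 15 + 42 * ?s"
      using s(1) by linarith
    also have "\<dots> \<le> ?s * (1000 * ?B ^ 15)"
    proof -
      have "?s * 1 \<le> ?s * ?B ^ 15"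
        by (rule mult_le_mono2) (use pow_large[of 15] in linarith)
      then show ?thesis
        by linarith
    qed
    also have "\<dots> \<le> ?s * ?B ^ 16"
      using pow_Suc_ge[of 15] by (intro mult_le_mono2) simp
    also have "\<dots> \<le> ?s ^ 2 + (?B ^ 16) ^ 2"
      by (rule mult_le_sum_squares)
    also have "(?B ^ 16) ^ 2 = n ^ 2 ^ (4 * k\<^sup>2 + 5)"
      by (simp add: power_mult[symmetric] power_add mult.commute)
    finally have "?s * ?B ^ 15 + 20 * ?s + 20 + 2 \<le> 50 * ?s ^ 50 + n ^ 2 ^ (4 * k\<^sup>2 + 5)"
      using s(3) by linarith
    with runs_imp_outputs_within[OF main_runs[OF assms(3,1) True]] show ?thesis
      by (rule that)
  qed
  then show ?thesis
    unfolding solves_dichromatic_within_def part outputs_within_def by (meson order_trans)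
qed

section \<open>Arithmetic of the final bound\<close>

lemma quadratic_bigo:
  assumes "\<And>k. 1 \<le> k \<Longrightarrow> f k \<le> c * k\<^sup>2"
  shows "(\<lambda>k. real (f k)) \<in> O(\<lambda>k. real k ^ 2)"
proof (rule bigoI)
  show "eventually (\<lambda>k. norm (real (f k)) \<le> real c * norm (real k ^ 2)) at_top"
    using eventually_ge_at_top[of 1]
  proof eventually_elim
    case (elim k)
    then have "real (f k) \<le> real (c * k\<^sup>2)"
      using assms by (intro of_nat_mono) simp
    then show ?case
      by simp
  qed
qed

text \<open>As \<open>n\<close> is at least 2, \<open>j \<le> n ^ j\<close> turns \<open>d\<close>
  and \<open>k\<close> into powers of \<open>n\<close>, and \<open>50 \<le> n ^ 6\<close>. A sum of
  two numbers that are at least 2 is at most their product; this is used once for powers of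
  \<open>n\<close> and once in the exponent. The summand added to the exponent is linear in
  \<open>k\<close>, so the exponent stays quadratic.\<close>

lemma absorb_size:
  fixes n k d s :: nat
  assumes "2 \<le> n" "s \<le> d * k\<^sup>2 * n"
  shows "50 * s ^ 50 + n ^ 2 ^ (4 * k\<^sup>2 + 5) \<le> n ^ 2 ^ (6 + 50 * (d + 2 * k + 1) + (4 * k\<^sup>2 + 5))"
proof -
  have le: "j \<le> n ^ j" for j
    using less_exp[of j] power_mono[of 2 n j] assms(1) by linarith
  let ?e = "6 + 50 * (d + 2 * k + 1)" and ?a = "4 * k\<^sup>2 + 5"
  have sum_le_prod: "x + y \<le> x * y" if xy: "2 \<le> x" "2 \<le> y" for x y :: nat
  proof -
    obtain x' y' where "x = 2 + x'" "y = 2 + y'"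
      using le_Suc_ex[OF xy(1)] le_Suc_ex[OF xy(2)] by auto
    then show ?thesis
      by (simp add: algebra_simps)
  qed
  have "s \<le> n ^ d * (n ^ k)\<^sup>2 * n"
    using assms(2) by (rule order_trans) (intro mult_le_mono power_mono le order_refl; simp)
  then have "s \<le> n ^ (d + 2 * k + 1)"
    by (simp add: power_add power_mult[symmetric] mult.commute)
  moreover have "(50 :: nat) \<le> n ^ 6"
    using power_mono[of 2 n 6] assms(1) by simp
  ultimately have "50 * s ^ 50 \<le> n ^ 6 * (n ^ (d + 2 * k + 1)) ^ 50"
    by (intro mult_le_mono power_mono) auto
  also have "\<dots> = n ^ ?e"
    by (simp only: mult.commute[of _ 50] power_add[symmetric] power_mult[symmetric])
  finally have "50 * s ^ 50 + n ^ 2 ^ ?a \<le> n ^ ?e + n ^ 2 ^ ?a"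
    by simp
  also have "\<dots> \<le> n ^ ?e * n ^ 2 ^ ?a"
    using power_increasing[of 1 ?e n] power_increasing[of 1 "2 ^ ?a" n] assms(1)
    by (intro sum_le_prod) auto
  also have "\<dots> = n ^ (?e + 2 ^ ?a)"
    by (simp only: power_add)
  also have "\<dots> \<le> n ^ 2 ^ (?e + ?a)"
  proof (rule power_increasing)
    have "?e + 2 ^ ?a \<le> 2 ^ ?e + 2 ^ ?a"
      using less_exp[of ?e] by simp
    also have "\<dots> \<le> 2 ^ ?e * 2 ^ ?a"
      using power_increasing[of 1 ?e "2 :: nat"] power_increasing[of 1 ?a "2 :: nat"]
      by (intro sum_le_prod) auto
    finally show "?e + 2 ^ ?a \<le> 2 ^ (?e + ?a)"
      by (simp only: power_add)
  qed (use assms(1) in simp)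
  finally show ?thesis .
qed

text \<open>One program serves all \<open>d\<close>: only the analysis depends on it. The first half
  follows from the same bound as the second by absorbing the polynomial in the size of the
  expression.\<close>

theorem theorem4p12:
  "\<exists>P :: program.
     (\<forall>d :: nat. \<exists>f :: nat \<Rightarrow> nat. (\<lambda>k. real (f k)) \<in> O(\<lambda>k. real k ^ 2) \<and>
        (\<forall>k X r n. dcw_k_exp k X \<longrightarrow> n = card (pverts (dcw_digraph X)) \<longrightarrow>
           1 \<le> r \<longrightarrow> r \<le> n \<longrightarrow> 2 \<le> n \<longrightarrow> dcw_size X \<le> d * k ^ 2 * n \<longrightarrow>
           solves_dichromatic_within P X r (n ^ (2 ^ f k)))) \<and>
     (\<exists>(c :: nat) (f :: nat \<Rightarrow> nat). (\<lambda>k. real (f k)) \<in> O(\<lambda>k. real k ^ 2) \<and>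
        (\<forall>k X r n. dcw_k_exp k X \<longrightarrow> n = card (pverts (dcw_digraph X)) \<longrightarrow>
           1 \<le> r \<longrightarrow> r \<le> n \<longrightarrow>
           solves_dichromatic_within P X r (c * dcw_size X ^ c + n ^ (2 ^ f k))))"
proof (intro exI[of _ dichrom] conjI allI)
  fix d :: nat
  let ?f = "\<lambda>k. 6 + 50 * (d + 2 * k + 1) + (4 * k\<^sup>2 + 5)"
  have "(\<lambda>k. real (?f k)) \<in> O(\<lambda>k. real k ^ 2)"
  proof (rule quadratic_bigo)
    fix k :: nat assume "1 \<le> k"
    then have "1 \<le> k\<^sup>2" "k \<le> k\<^sup>2" "d \<le> d * k\<^sup>2"
      by (simp_all add: power2_eq_square)
    \<comment> \<open>\<open>x\<close> and \<open>y\<close> stand for \<open>k\<^sup>2\<close> and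
      \<open>d * k\<^sup>2\<close>, which leaves a linear inequality.\<close>
    moreover have "6 + 50 * (d + 2 * k + 1) + (4 * x + 5) \<le> 200 * x + 50 * y"
      if "1 \<le> x" "k \<le> x" "d \<le> y" for x y
      using that by (simp add: distrib_left)
    ultimately have "?f k \<le> 200 * k\<^sup>2 + 50 * (d * k\<^sup>2)"
      by blast
    then show "?f k \<le> (200 + 50 * d) * k\<^sup>2"
      by (simp only: add_mult_distrib mult.assoc)
  qed
  moreover have "solves_dichromatic_within dichrom X r (n ^ (2 ^ ?f k))"
    if "dcw_k_exp k X" "n = card (pverts (dcw_digraph X))" "1 \<le> r" "r \<le> n" "2 \<le> n"
      "dcw_size X \<le> d * k ^ 2 * n" for k X r n
    using dichrom_solves[OF that(1-4)] absorb_size[OF that(5,6)]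
    unfolding solves_dichromatic_within_def outputs_within_def by (meson order_trans)
  ultimately show "\<exists>f. (\<lambda>k. real (f k)) \<in> O(\<lambda>k. real k ^ 2) \<and>
        (\<forall>k X r n. dcw_k_exp k X \<longrightarrow> n = card (pverts (dcw_digraph X)) \<longrightarrow>
           1 \<le> r \<longrightarrow> r \<le> n \<longrightarrow> 2 \<le> n \<longrightarrow> dcw_size X \<le> d * k ^ 2 * n \<longrightarrow>
           solves_dichromatic_within dichrom X r (n ^ (2 ^ f k)))"
    by (intro exI[of _ ?f]) blast
next
  have "(\<lambda>k. real (4 * k\<^sup>2 + 5)) \<in> O(\<lambda>k. real k ^ 2)"
    by (rule quadratic_bigo[of _ 9]) simp
  then show "\<exists>(c :: nat) (f :: nat \<Rightarrow> nat). (\<lambda>k. real (f k)) \<in> O(\<lambda>k. real k ^ 2) \<and>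
        (\<forall>k X r n. dcw_k_exp k X \<longrightarrow> n = card (pverts (dcw_digraph X)) \<longrightarrow>
           1 \<le> r \<longrightarrow> r \<le> n \<longrightarrow>
           solves_dichromatic_within dichrom X r (c * dcw_size X ^ c + n ^ (2 ^ f k)))"
    using dichrom_solves by (intro exI[of _ 50] exI[of _ "\<lambda>k. 4 * k\<^sup>2 + 5"]) blast
qed

end
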